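(* Let $v=(v_n)_{n\ge1}$ be a sequence of strictly positive numbers. A hypercyclic weighted shift $B_w$ on the real or complex space $l^p(v)$, $1\le p<\infty$, possesses a hypercyclic subspace if and only if $$\sup_{n\ge 1}\inf_{k\ge 1}\prod_{\nu=1}^n|w_{\nu+k}|\Big(\frac{v_k}{v_{k+n}}\Big)^{\frac1p}\le 1,$$ or equivalently if and only if $$\sup_{n\ge 1}\inf_{k\ge 1}\prod_{\nu=1}^n|w_{\nu+k}|\Big(\frac{v_k}{v_{k+n}}\Big)^{\frac1p}<\infty;$$ and a hypercyclic weighted shift $B_w$ on the real or complex space $c_0(v)$ possesses a hypercyclic subspace if and only if $$\sup_{n\ge 1}\inf_{k\ge 1}\prod_{\nu=1}^n|w_{\nu+k}|\Big(\frac{v_k}{v_{k+n}}\Big)\le 1,$$ or equivalently if and only if $$\sup_{n\ge 1}\inf_{k\ge 1}\prod_{\nu=1}^n|w_{\nu+k}|\Big(\frac{v_k}{v_{k+n}}\Big)<\infty.$$ In these formulas the factor $\big(\frac{v_k}{v_{k+n}}\big)^{1/p}$, respectively $\frac{v_k}{v_{k+n}}$, is not affected by the product index $\nu$: it multiplies the product $\prod_{\nu=1}^n|w_{\nu+k}|$ once.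
   Context: $l^p(v)=\{(x_n)_{n\ge1}:\sum_{n=1}^\infty|x_n|^pv_n<\infty\}$ with norm $(\sum_n|x_n|^pv_n)^{1/p}$, and $c_0(v)=\{(x_n)_{n\ge1}:\lim_{n\to\infty}|x_n|v_n=0\}$ with norm $\max_n|x_n|v_n$. $(e_n)_{n\ge1}$ is the canonical basis. For a sequence $w=(w_n)_{n\ge 1}$ of non-zero scalars, the weighted shift $B_w:X\to X$ is the continuous linear operator with $B_we_n=w_ne_{n-1}$ for $n\ge1$, where $e_0=0$. A vector $x$ is hypercyclic for $B_w$ if $\{B_w^nx:n\ge 1\}$ is dense in $X$; $B_w$ is hypercyclic if it has a hypercyclic vector. A hypercyclic subspace for $B_w$ is an infinite-dimensional closed linear subspace of $X$ in which every non-zero vector is hypercyclic for $B_w$. *)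

theory Defs
  imports "HOL-Analysis.Analysis" "HOL-Library.Function_Algebras"
begin

text \<open>
  A scalar sequence \<open>(x\<^sub>n)\<close>, \<open>n \<ge> 1\<close>, is a function on \<^typ>\<open>nat\<close> with \<open>x 0 = 0\<close>.  The convention
  at index \<open>0\<close> is imposed in the definitions of \<open>lp_space\<close> and \<open>c0_space\<close> and agrees with
  \<open>e\<^sub>0 = 0\<close>.  Addition and zero of sequences are the pointwise ones of
  \<^theory>\<open>HOL-Library.Function_Algebras\<close>.  The value at \<open>0\<close> of the weights \<open>v\<close> and \<open>w\<close> is never used.
\<close>

definition scale_seq :: "'a::field \<Rightarrow> (nat \<Rightarrow> 'a) \<Rightarrow> (nat \<Rightarrow> 'a)" where
  "scale_seq c x = (\<lambda>n. c * x n)"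

global_interpretation seq: vector_space "scale_seq :: 'a::field \<Rightarrow> (nat \<Rightarrow> 'a) \<Rightarrow> (nat \<Rightarrow> 'a)"
  by unfold_locales (auto simp: scale_seq_def fun_eq_iff algebra_simps)

definition unit_seq :: "nat \<Rightarrow> nat \<Rightarrow> 'a::zero_neq_one" where
  "unit_seq n = (\<lambda>k. if k = n \<and> 1 \<le> n then 1 else 0)"


definition lp_space :: "real \<Rightarrow> (nat \<Rightarrow> real) \<Rightarrow> (nat \<Rightarrow> 'a::real_normed_field) set" where
  "lp_space p v = {x. x 0 = 0 \<and> (\<lambda>n. norm (x n) powr p * v n) summable_on {1..}}"

definition lp_norm :: "real \<Rightarrow> (nat \<Rightarrow> real) \<Rightarrow> (nat \<Rightarrow> 'a::real_normed_field) \<Rightarrow> real" where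
  "lp_norm p v x = (\<Sum>\<^sub>\<infinity>n\<in>{1..}. norm (x n) powr p * v n) powr (1 / p)"

definition c0_space :: "(nat \<Rightarrow> real) \<Rightarrow> (nat \<Rightarrow> 'a::real_normed_field) set" where
  "c0_space v = {x. x 0 = 0 \<and> (\<lambda>n. norm (x n) * v n) \<longlonglongrightarrow> 0}"

text \<open>On \<open>c0_space v\<close> the supremum is over a bounded set and is attained.\<close>

definition c0_norm :: "(nat \<Rightarrow> real) \<Rightarrow> (nat \<Rightarrow> 'a::real_normed_field) \<Rightarrow> real" where
  "c0_norm v x = (SUP n\<in>{1..}. norm (x n) * v n)"

text \<open>
  The distance is set to \<open>0\<close> off the carrier only because \<^locale>\<open>Metric_space\<close> demands
  nonnegativity there as well; the topology depends on its values on the carrier alone.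
\<close>

definition norm_dist ::
    "(nat \<Rightarrow> 'a::real_normed_field) set \<Rightarrow> ((nat \<Rightarrow> 'a) \<Rightarrow> real) \<Rightarrow> (nat \<Rightarrow> 'a) \<Rightarrow> (nat \<Rightarrow> 'a) \<Rightarrow> real" where
  "norm_dist X N x y = (if x \<in> X \<and> y \<in> X then N (x - y) else 0)"

definition norm_topology ::
    "(nat \<Rightarrow> 'a::real_normed_field) set \<Rightarrow> ((nat \<Rightarrow> 'a) \<Rightarrow> real) \<Rightarrow> (nat \<Rightarrow> 'a) topology" where
  "norm_topology X N = Metric_space.mtopology X (norm_dist X N)"

definition lp_topology :: "real \<Rightarrow> (nat \<Rightarrow> real) \<Rightarrow> (nat \<Rightarrow> 'a::real_normed_field) topology" where
  "lp_topology p v = norm_topology (lp_space p v) (lp_norm p v)"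

definition c0_topology :: "(nat \<Rightarrow> real) \<Rightarrow> (nat \<Rightarrow> 'a::real_normed_field) topology" where
  "c0_topology v = norm_topology (c0_space v) (c0_norm v)"


text \<open>
  Operators on \<open>X = topspace \<tau>\<close> are total functions on sequences of which only the restriction to
  \<open>X\<close> matters.  \<^const>\<open>continuous_map\<close> includes that \<open>B\<close> maps \<open>X\<close> into \<open>X\<close>.
\<close>

definition weighted_shift ::
    "(nat \<Rightarrow> 'a::real_normed_field) topology \<Rightarrow> (nat \<Rightarrow> 'a) \<Rightarrow> ((nat \<Rightarrow> 'a) \<Rightarrow> (nat \<Rightarrow> 'a)) \<Rightarrow> bool" where
  "weighted_shift \<tau> w B \<longleftrightarrow>
     (\<forall>n\<ge>1. w n \<noteq> 0) \<and>
     continuous_map \<tau> \<tau> B \<and>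
     (\<forall>x\<in>topspace \<tau>. \<forall>y\<in>topspace \<tau>. B (x + y) = B x + B y) \<and>
     (\<forall>c. \<forall>x\<in>topspace \<tau>. B (scale_seq c x) = scale_seq c (B x)) \<and>
     (\<forall>n\<ge>1. B (unit_seq n) = scale_seq (w n) (unit_seq (n - 1)))"

definition hypercyclic_vector :: "'b topology \<Rightarrow> ('b \<Rightarrow> 'b) \<Rightarrow> 'b \<Rightarrow> bool" where
  "hypercyclic_vector \<tau> B x \<longleftrightarrow>
     x \<in> topspace \<tau> \<and> \<tau> closure_of {(B ^^ n) x | n. 1 \<le> n} = topspace \<tau>"

definition hypercyclic :: "'b topology \<Rightarrow> ('b \<Rightarrow> 'b) \<Rightarrow> bool" where
  "hypercyclic \<tau> B \<longleftrightarrow> (\<exists>x. hypercyclic_vector \<tau> B x)"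

definition hypercyclic_subspace ::
    "(nat \<Rightarrow> 'a::real_normed_field) topology \<Rightarrow> ((nat \<Rightarrow> 'a) \<Rightarrow> (nat \<Rightarrow> 'a)) \<Rightarrow> (nat \<Rightarrow> 'a) set \<Rightarrow> bool" where
  "hypercyclic_subspace \<tau> B M \<longleftrightarrow>
     closedin \<tau> M \<and> seq.subspace M \<and>
     \<not> (\<exists>S. finite S \<and> M = seq.span S) \<and>
     (\<forall>x\<in>M. x \<noteq> 0 \<longrightarrow> hypercyclic_vector \<tau> B x)"


text \<open>The suprema are taken in \<^typ>\<open>ereal\<close> because they may be infinite.\<close>

definition lp_sup_inf :: "real \<Rightarrow> (nat \<Rightarrow> real) \<Rightarrow> (nat \<Rightarrow> 'a::real_normed_field) \<Rightarrow> ereal" where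
  "lp_sup_inf p v w =
     (SUP n\<in>{1::nat..}. INF k\<in>{1::nat..}.
        ereal ((\<Prod>\<nu>=1..n. norm (w (\<nu> + k))) * (v k / v (k + n)) powr (1 / p)))"

definition c0_sup_inf :: "(nat \<Rightarrow> real) \<Rightarrow> (nat \<Rightarrow> 'a::real_normed_field) \<Rightarrow> ereal" where
  "c0_sup_inf v w =
     (SUP n\<in>{1::nat..}. INF k\<in>{1::nat..}.
        ereal ((\<Prod>\<nu>=1..n. norm (w (\<nu> + k))) * (v k / v (k + n))))"


text \<open>
  The distances above are metrics, so that the topologies are the norm topologies of
  \<open>l\<^sup>p(v)\<close> and \<open>c\<^sub>0(v)\<close>.
\<close>

lemma Metric_space_norm_dist:
  assumes X: "seq.subspace X"
    and nonneg: "\<And>x. x \<in> X \<Longrightarrow> 0 \<le> N x"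
    and zero: "\<And>x. x \<in> X \<Longrightarrow> N x = 0 \<longleftrightarrow> x = 0"
    and minus: "\<And>x. N (- x) = N x"
    and add: "\<And>x y. x \<in> X \<Longrightarrow> y \<in> X \<Longrightarrow> N (x + y) \<le> N x + N y"
  shows "Metric_space X (norm_dist X N)"
proof
  fix x y z
  show "0 \<le> norm_dist X N x y"
    using X nonneg by (simp add: norm_dist_def seq.subspace_diff)
  show "norm_dist X N x y = norm_dist X N y x"
    using minus[of "x - y"] by (simp add: norm_dist_def)
  show "norm_dist X N x y = 0 \<longleftrightarrow> x = y" if "x \<in> X" "y \<in> X"
    using that X zero[of "x - y"] by (simp add: norm_dist_def seq.subspace_diff)
  show "norm_dist X N x z \<le> norm_dist X N x y + norm_dist X N y z"
    if "x \<in> X" "y \<in> X" "z \<in> X"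
    using that X add[of "x - y" "y - z"] by (simp add: norm_dist_def seq.subspace_diff)
qed

lemma powr_convex_comb:
  fixes a b s t p :: real
  assumes p: "1 \<le> p" and a: "0 < a" and b: "0 < b" and s: "0 \<le> s" and t: "0 \<le> t"
  shows "(s + t) powr p \<le> (a + b) powr p * (a / (a + b) * (s / a) powr p + b / (a + b) * (t / b) powr p)"
proof -
  define l m where "l = a / (a + b)" and "m = b / (a + b)"
  have lm: "0 \<le> l" "l \<le> 1" "0 \<le> m" "m \<le> 1" "l + m = 1"
    using a b by (auto simp: l_def m_def add_divide_distrib[symmetric])
  have pow: "c powr p \<le> c" if "0 \<le> c" "c \<le> 1" for c :: real
    using powr_mono'[of 1 p c] that p by (simp add: powr_one)
  have conv: "(l * u + m * r) powr p \<le> l * u powr p + m * r powr p" if u: "0 \<le> u" and r: "0 \<le> r" for u r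
  proof (cases "u = 0 \<or> r = 0")
    case True
    then show ?thesis
      using u r lm p pow[of l] pow[of m] by (auto simp: powr_mult mult_right_mono)
  next
    case False
    with u r have "u \<in> {0<..}" "r \<in> {0<..}" by auto
    then show ?thesis
      using powr_convex[OF p] lm unfolding convex_on_def by (metis real_scaleR_def)
  qed
  have "(a + b) * l = a" "(a + b) * m = b"
    using a b by (simp_all add: l_def m_def)
  then have "(a + b) * (l * (s / a) + m * (t / b)) = a * (s / a) + b * (t / b)"
    by (simp only: distrib_left mult.assoc[symmetric])
  then have "s + t = (a + b) * (l * (s / a) + m * (t / b))"
    using a b by simp
  then have "(s + t) powr p = (a + b) powr p * (l * (s / a) + m * (t / b)) powr p"
    using a b s t lm by (simp add: powr_mult)
  also have "\<dots> \<le> (a + b) powr p * (l * (s / a) powr p + m * (t / b) powr p)"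
    using conv[rule_format, of "s / a" "t / b"] a b s t by (intro mult_left_mono) auto
  finally show ?thesis by (simp add: l_def m_def)
qed

lemma lp_add:
  fixes x y :: "nat \<Rightarrow> 'a::real_normed_field"
  assumes v: "\<forall>n\<ge>1. 0 < v n" and p: "1 \<le> p"
    and x: "x \<in> lp_space p v" and y: "y \<in> lp_space p v"
  shows "x + y \<in> lp_space p v" "lp_norm p v (x + y) \<le> lp_norm p v x + lp_norm p v y"
proof -
  define F where "F = (\<lambda>(x :: nat \<Rightarrow> 'a) n. norm (x n) powr p * v n)"
  have F0: "0 \<le> F z n" if "n \<in> {1..}" for z n
    using that v[rule_format, of n] by (simp add: F_def)
  have S: "F x summable_on {1..}" "F y summable_on {1..}"
    using x y by (auto simp: lp_space_def F_def)
  define c where "c = (\<lambda>a b a'. (a + b) powr p * (a' / (a + b)) * (1 / a') powr p :: real)"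
  have pw: "F (x + y) n \<le> c a b a * F x n + c a b b * F y n"
    if a: "0 < a" and b: "0 < b" and n: "n \<in> {1..}" for a b n
  proof -
    have *: "norm ((x + y) n) powr p \<le> (norm (x n) + norm (y n)) powr p"
      using p by (intro powr_mono2) (auto simp: norm_triangle_ineq)
    also have "\<dots> \<le> (a + b) powr p * (a / (a + b) * (norm (x n) / a) powr p + b / (a + b) * (norm (y n) / b) powr p)"
      using powr_convex_comb[OF p a b] by simp
    also have "\<dots> = c a b a * norm (x n) powr p + c a b b * norm (y n) powr p"
      using a b by (simp add: c_def powr_divide ring_distribs)
    finally have "norm ((x + y) n) powr p * v n
        \<le> (c a b a * norm (x n) powr p + c a b b * norm (y n) powr p) * v n"
      using v[rule_format, of n] n by (intro mult_right_mono) auto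
    then show ?thesis by (simp add: F_def algebra_simps)
  qed
  have Sc: "(\<lambda>n. c a b a' * F x n + c a b b' * F y n) summable_on {1..}" for a b a' b'
    using S by (intro summable_on_add summable_on_cmult_right)
  have Sxy: "F (x + y) summable_on {1..}"
    by (rule summable_on_comparison_test[OF Sc[of 1 1 1 1]]) (use pw[of 1 1] F0 in auto)
  then show "x + y \<in> lp_space p v"
    using x y by (simp add: lp_space_def F_def)
  have N: "lp_norm p v z = infsum (F z) {1..} powr (1 / p)" for z
    by (simp add: lp_norm_def F_def)
  have pos: "0 \<le> infsum (F z) {1..}" for z
    using F0 by (intro infsum_nonneg) auto
  have bound: "lp_norm p v (x + y) \<le> a + b" if a: "lp_norm p v x < a" and b: "lp_norm p v y < b" for a b
  proof -
    have a0: "0 < a" and b0: "0 < b"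
      using a b by (auto simp: N intro: le_less_trans[OF powr_ge_zero])
    have le: "infsum (F z) {1..} \<le> d powr p" if "lp_norm p v z < d" for z d
    proof -
      have "infsum (F z) {1..} = lp_norm p v z powr p"
        using p pos[of z] by (simp add: N powr_powr)
      also have "\<dots> \<le> d powr p"
        using that p by (intro powr_mono2) (auto simp: N)
      finally show ?thesis .
    qed
    have c1: "c a b a * a powr p = (a + b) powr p * (a / (a + b))"
      "c a b b * b powr p = (a + b) powr p * (b / (a + b))"
      using a0 b0 by (auto simp: c_def powr_divide)
    have c0: "0 \<le> c a b a" "0 \<le> c a b b" using a0 b0 by (auto simp: c_def)
    have "infsum (F (x + y)) {1..} \<le> (\<Sum>\<^sub>\<infinity>n\<in>{1..}. c a b a * F x n + c a b b * F y n)"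
      using pw[OF a0 b0] by (intro infsum_mono Sxy Sc) auto
    also have "\<dots> = c a b a * infsum (F x) {1..} + c a b b * infsum (F y) {1..}"
      using S by (subst infsum_add) (auto intro: summable_on_cmult_right simp: infsum_cmult_right)
    also have "\<dots> \<le> c a b a * a powr p + c a b b * b powr p"
      using le[OF a] le[OF b] c0 by (intro add_mono mult_left_mono) auto
    also have "\<dots> = (a + b) powr p * ((a + b) / (a + b))"
      unfolding c1 by (simp only: add_divide_distrib ring_distribs)
    also have "\<dots> = (a + b) powr p" using a0 b0 by simp
    finally have "lp_norm p v (x + y) \<le> ((a + b) powr p) powr (1 / p)"
      unfolding N using p pos by (intro powr_mono2) auto
    then show ?thesis using p a0 b0 by (simp add: powr_powr)
  qed
  show "lp_norm p v (x + y) \<le> lp_norm p v x + lp_norm p v y"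
  proof (rule field_le_epsilon)
    fix e :: real assume "0 < e"
    then show "lp_norm p v (x + y) \<le> lp_norm p v x + lp_norm p v y + e"
      using bound[of "lp_norm p v x + e / 2" "lp_norm p v y + e / 2"] by simp
  qed
qed

lemma subspace_lp_space:
  assumes "\<forall>n\<ge>1. 0 < v n" and "1 \<le> p"
  shows "seq.subspace (lp_space p v :: (nat \<Rightarrow> 'a::real_normed_field) set)"
proof (rule seq.subspaceI)
  show "(0 :: nat \<Rightarrow> 'a) \<in> lp_space p v"
    by (simp add: lp_space_def)
  show "x + y \<in> lp_space p v" if "x \<in> lp_space p v" "y \<in> lp_space p v" for x y :: "nat \<Rightarrow> 'a"
    using lp_add[OF assms that] by simp
  show "scale_seq c x \<in> lp_space p v" if "x \<in> lp_space p v" for c and x :: "nat \<Rightarrow> 'a"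
    using that
    by (auto simp: lp_space_def scale_seq_def norm_mult powr_mult mult.assoc intro: summable_on_cmult_right)
qed

lemma Metric_space_lp:
  assumes v: "\<forall>n\<ge>1. 0 < v n" and p: "1 \<le> p"
  shows "Metric_space (lp_space p v :: (nat \<Rightarrow> 'a::real_normed_field) set)
           (norm_dist (lp_space p v) (lp_norm p v))"
proof (rule Metric_space_norm_dist)
  show "seq.subspace (lp_space p v :: (nat \<Rightarrow> 'a) set)"
    using subspace_lp_space[OF assms] .
  fix x :: "nat \<Rightarrow> 'a"
  show "0 \<le> lp_norm p v x" by (simp add: lp_norm_def)
  show "lp_norm p v (- x) = lp_norm p v x" by (simp add: lp_norm_def)
  show "lp_norm p v x = 0 \<longleftrightarrow> x = 0" if x: "x \<in> lp_space p v"
  proof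
    assume "lp_norm p v x = 0"
    then have z: "(\<Sum>\<^sub>\<infinity>n\<in>{1..}. norm (x n) powr p * v n) = 0"
      by (simp add: lp_norm_def)
    have "x n = 0" if n: "1 \<le> n" for n
    proof -
      have "norm (x n) powr p * v n = 0"
        by (rule nonneg_infsum_le_0D[where A = "{1..}"])
          (use x n z v in \<open>auto simp: lp_space_def less_imp_le\<close>)
      then show ?thesis using v[rule_format, OF n] by simp
    qed
    moreover have "x 0 = 0" using x by (simp add: lp_space_def)
    ultimately show "x = 0" by (metis One_nat_def Suc_leI gr0I ext zero_fun_apply)
  qed (simp add: lp_norm_def)
  fix y :: "nat \<Rightarrow> 'a"
  assume "x \<in> lp_space p v" "y \<in> lp_space p v"
  then show "lp_norm p v (x + y) \<le> lp_norm p v x + lp_norm p v y"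
    using lp_add[OF assms] by blast
qed

lemma c0_norm_upper:
  assumes "x \<in> c0_space v" and "1 \<le> n"
  shows "norm (x n) * v n \<le> c0_norm v x"
proof -
  have "(\<lambda>n. norm (x n) * v n) \<longlonglongrightarrow> 0"
    using assms by (simp add: c0_space_def)
  then have "bdd_above (range (\<lambda>n. norm (x n) * v n))"
    by (intro Bseq_eq_bounded[THEN iffD1, THEN bounded_imp_bdd_above]
        convergent_imp_Bseq convergentI)
  then have "bdd_above ((\<lambda>n. norm (x n) * v n) ` {1..})"
    by (rule bdd_above_mono) auto
  then show ?thesis
    unfolding c0_norm_def using assms(2) by (intro cSUP_upper) auto
qed

lemma c0_add:
  assumes v: "\<forall>n\<ge>1. 0 < v n" and x: "x \<in> c0_space v" and y: "y \<in> c0_space v"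
  shows "x + y \<in> c0_space v" "c0_norm v (x + y) \<le> c0_norm v x + c0_norm v y"
proof -
  have le: "norm ((x + y) n) * v n \<le> norm (x n) * v n + norm (y n) * v n" if "1 \<le> n" for n
    using mult_right_mono[OF norm_triangle_ineq[of "x n" "y n"], of "v n"] v[rule_format, OF that]
    by (simp add: algebra_simps)
  have "(\<lambda>n. norm (x n) * v n + norm (y n) * v n) \<longlonglongrightarrow> 0 + 0"
    using x y by (intro tendsto_add) (auto simp: c0_space_def)
  then have "(\<lambda>n. norm ((x + y) n) * v n) \<longlonglongrightarrow> 0"
    by (intro tendsto_sandwich[of "\<lambda>_. 0" "\<lambda>n. norm ((x + y) n) * v n" _
          "\<lambda>n. norm (x n) * v n + norm (y n) * v n"])
      (use le v in \<open>auto intro!: eventually_sequentiallyI[of 1] simp: less_imp_le\<close>)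
  then show "x + y \<in> c0_space v" using x y by (simp add: c0_space_def)
  show "c0_norm v (x + y) \<le> c0_norm v x + c0_norm v y"
    unfolding c0_norm_def[of v "x + y"]
  proof (rule cSUP_least)
    fix n :: nat assume "n \<in> {1..}"
    then show "norm ((x + y) n) * v n \<le> c0_norm v x + c0_norm v y"
      using le[of n] c0_norm_upper[OF x, of n] c0_norm_upper[OF y, of n] by simp
  qed auto
qed

lemma subspace_c0_space:
  assumes "\<forall>n\<ge>1. 0 < v n"
  shows "seq.subspace (c0_space v :: (nat \<Rightarrow> 'a::real_normed_field) set)"
proof (rule seq.subspaceI)
  show "(0 :: nat \<Rightarrow> 'a) \<in> c0_space v"
    by (simp add: c0_space_def)
  show "x + y \<in> c0_space v" if "x \<in> c0_space v" "y \<in> c0_space v" for x y :: "nat \<Rightarrow> 'a"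
    using c0_add[OF assms that] by simp
  show "scale_seq c x \<in> c0_space v" if "x \<in> c0_space v" for c and x :: "nat \<Rightarrow> 'a"
    using that tendsto_mult_right_zero[of "\<lambda>n. norm (x n) * v n" sequentially "norm c"]
    by (auto simp: c0_space_def scale_seq_def norm_mult mult.assoc)
qed

lemma Metric_space_c0:
  assumes v: "\<forall>n\<ge>1. 0 < v n"
  shows "Metric_space (c0_space v :: (nat \<Rightarrow> 'a::real_normed_field) set)
           (norm_dist (c0_space v) (c0_norm v))"
proof (rule Metric_space_norm_dist)
  show "seq.subspace (c0_space v :: (nat \<Rightarrow> 'a) set)"
    using subspace_c0_space[OF assms] .
  fix x :: "nat \<Rightarrow> 'a"
  show "c0_norm v (- x) = c0_norm v x" by (simp add: c0_norm_def)
  show "0 \<le> c0_norm v x" if x: "x \<in> c0_space v"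
  proof -
    have "0 \<le> norm (x 1) * v 1" using v[rule_format, of 1] by simp
    also have "\<dots> \<le> c0_norm v x" using c0_norm_upper[OF x, of 1] by simp
    finally show ?thesis .
  qed
  show "c0_norm v x = 0 \<longleftrightarrow> x = 0" if x: "x \<in> c0_space v"
  proof
    assume z: "c0_norm v x = 0"
    have "x n = 0" if n: "1 \<le> n" for n
      using c0_norm_upper[OF x n] v[rule_format, OF n] z by (simp add: mult_le_0_iff)
    moreover have "x 0 = 0" using x by (simp add: c0_space_def)
    ultimately show "x = 0" by (metis One_nat_def Suc_leI gr0I ext zero_fun_apply)
  qed (simp add: c0_norm_def)
  fix y :: "nat \<Rightarrow> 'a"
  assume "x \<in> c0_space v" "y \<in> c0_space v"
  then show "c0_norm v (x + y) \<le> c0_norm v x + c0_norm v y"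
    using c0_add[OF assms] by blast
qed

lemma topspace_lp_topology:
  assumes "\<forall>n\<ge>1. 0 < v n" and "1 \<le> p"
  shows "topspace (lp_topology p v) = (lp_space p v :: (nat \<Rightarrow> 'a::real_normed_field) set)"
  unfolding lp_topology_def norm_topology_def
  by (rule Metric_space.topspace_mtopology[OF Metric_space_lp[OF assms]])

lemma topspace_c0_topology:
  assumes "\<forall>n\<ge>1. 0 < v n"
  shows "topspace (c0_topology v) = (c0_space v :: (nat \<Rightarrow> 'a::real_normed_field) set)"
  unfolding c0_topology_def norm_topology_def
  by (rule Metric_space.topspace_mtopology[OF Metric_space_c0[OF assms]])

end

theory Submission
  imports Defs
begin

text \<open>
  Let \<open>u k\<close> be the norm of the \<open>k\<close>-th unit sequence and \<open>A n k\<close> the norm of \<open>B ^^ n\<close> on the line of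
  the unit sequence at \<open>k + n\<close>; the quantity in question is the supremum over \<open>n\<close> of the infimum
  over \<open>k\<close> of \<open>A n k\<close>.

  If \<open>A n k \<ge> d > 1\<close> for one \<open>n\<close> and all \<open>k\<close>, then \<open>B ^^ (n * m)\<close> expands sequences supported beyond
  \<open>n * m\<close> by the factor \<open>d ^ m\<close>.  An infinite-dimensional closed subspace contains a vector whose
  tails decay more slowly than this expansion, and its orbit stays away from \<open>0\<close>.

  If the infima are bounded, there are arbitrarily late positions \<open>q\<close> such that the unit sequence at
  \<open>q\<close> grows by at most a factor 2 in its first \<open>L\<close> iterates, for \<open>L\<close> as large as desired.
  Hypercyclicity provides times \<open>n\<close> at which \<open>A n i\<close> is huge for all small \<open>i\<close>, so that every finite
  sequence has a tiny preimage under \<open>B ^^ n\<close>.  Choosing positions and times alternately, one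
  perturbs the unit sequences at the positions \<open>q\<close> by preimages of a dense sequence of targets.  All
  supports being disjoint, the closed span of the perturbed sequences is described by linear
  conditions on coordinates; a vector in it with a non-zero coefficient \<open>c\<close> at some position is
  mapped close to \<open>c\<close> times each target infinitely often.
\<close>

section \<open>Weighted sequence spaces\<close>

lemma sum_fun_apply: "(\<Sum>i\<in>I. f i) k = (\<Sum>i\<in>I. f i k)"
  by (induction I rule: infinite_finite_induct) auto

definition restrict_seq :: "nat set \<Rightarrow> (nat \<Rightarrow> 'a::zero) \<Rightarrow> nat \<Rightarrow> 'a" where
  "restrict_seq F x = (\<lambda>k. if k \<in> F then x k else 0)"

lemma restrict_seq_simps:
  "restrict_seq F (x + y) = restrict_seq F x + restrict_seq F (y :: nat \<Rightarrow> 'a::real_normed_field)"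
  "restrict_seq F (x - y) = restrict_seq F x - restrict_seq F (y :: nat \<Rightarrow> 'a)"
  "restrict_seq F (scale_seq c x) = scale_seq c (restrict_seq F (x :: nat \<Rightarrow> 'a))"
  by (auto simp: restrict_seq_def scale_seq_def)

lemma restrict_seq_eq_sum:
  fixes x :: "nat \<Rightarrow> 'a::real_normed_field"
  assumes "finite F" "F \<subseteq> {1..}"
  shows "restrict_seq F x = (\<Sum>k\<in>F. scale_seq (x k) (unit_seq k))"
  using assms
proof (induction F rule: finite_induct)
  case (insert k F)
  have "restrict_seq (insert k F) x = scale_seq (x k) (unit_seq k) + restrict_seq F x"
    using insert.hyps(2) insert.prems by (auto simp: restrict_seq_def scale_seq_def unit_seq_def)
  also have "restrict_seq F x = (\<Sum>k\<in>F. scale_seq (x k) (unit_seq k))"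
    using insert by auto
  finally show ?case by (simp only: sum.insert[OF insert.hyps])
qed (auto simp: restrict_seq_def)

text \<open>
  Solidity and the behaviour of the norm under restrictions and under the shifts in both directions
  are all instances of \<open>dominated\<close>.
\<close>

locale weighted_seq_space =
  fixes X :: "(nat \<Rightarrow> 'a::{real_normed_field,banach,second_countable_topology}) set"
    and N :: "(nat \<Rightarrow> 'a) \<Rightarrow> real" and u :: "nat \<Rightarrow> real"
  assumes u_pos: "1 \<le> k \<Longrightarrow> 0 < u k"
    and subspace: "seq.subspace X"
    and at_0: "x \<in> X \<Longrightarrow> x 0 = 0"
    and N_nonneg: "x \<in> X \<Longrightarrow> 0 \<le> N x"
    and N_minus: "N (- x) = N x"
    and N_add: "x \<in> X \<Longrightarrow> y \<in> X \<Longrightarrow> N (x + y) \<le> N x + N y"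
    and N_scale_le: "x \<in> X \<Longrightarrow> N (scale_seq c x) \<le> norm c * N x"
    and unit_in: "1 \<le> k \<Longrightarrow> unit_seq k \<in> X"
    and N_unit: "1 \<le> k \<Longrightarrow> N (unit_seq k) = u k"
    and dominated: "\<lbrakk>y \<in> X; inj_on \<sigma> S; S \<subseteq> {1..}; \<sigma> ` S \<subseteq> {1..}; \<And>k. k \<notin> S \<Longrightarrow> x k = 0;
        \<And>k. k \<in> S \<Longrightarrow> norm (x k) * u k \<le> norm (y (\<sigma> k)) * u (\<sigma> k)\<rbrakk> \<Longrightarrow> x \<in> X \<and> N x \<le> N y"
    and tail: "x \<in> X \<Longrightarrow> (\<lambda>n. N (restrict_seq {n<..} x)) \<longlonglongrightarrow> 0"
    and truncations_Cauchy: "\<lbrakk>x 0 = 0; \<And>e. 0 < e \<Longrightarrow> \<exists>n. \<forall>m. N (restrict_seq {n<..m} x) \<le> e\<rbrakk> \<Longrightarrow> x \<in> X"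
begin

lemmas zero_in = seq.subspace_0[OF subspace]
  and add_in = seq.subspace_add[OF subspace]
  and diff_in = seq.subspace_diff[OF subspace]
  and scale_in = seq.subspace_scale[OF subspace]
  and sum_in = seq.subspace_sum[OF subspace]

lemma solid:
  assumes "y \<in> X" "x 0 = 0" "\<And>k. 1 \<le> k \<Longrightarrow> norm (x k) \<le> norm (y k)"
  shows "x \<in> X" "N x \<le> N y"
proof -
  have "x \<in> X \<and> N x \<le> N y"
    by (rule dominated[where S = "{1..}" and \<sigma> = id])
      (use assms u_pos in \<open>auto simp: not_le intro!: mult_right_mono dest: less_imp_le\<close>)
  then show "x \<in> X" "N x \<le> N y" by auto
qed

lemma restrict_in: "x \<in> X \<Longrightarrow> restrict_seq F x \<in> X"
  and N_restrict: "x \<in> X \<Longrightarrow> N (restrict_seq F x) \<le> N x"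
  using solid[of x "restrict_seq F x"] at_0[of x] by (auto simp: restrict_seq_def)

lemma N_0 [simp]: "N 0 = 0"
  using N_scale_le[OF zero_in, of 0] N_nonneg[OF zero_in] by (simp add: scale_seq_def zero_fun_def)

text \<open>The locale asks only for \<open>N_scale_le\<close>; the reverse inequality is that axiom
  applied to \<open>inverse c\<close> and \<open>scale_seq c x\<close>.\<close>

lemma N_scale: assumes "x \<in> X" shows "N (scale_seq c x) = norm c * N x"
proof (cases "c = 0")
  case True
  then have "scale_seq c x = 0" by (simp add: scale_seq_def fun_eq_iff)
  then show ?thesis using True by simp
next
  case False
  have "N x = N (scale_seq (inverse c) (scale_seq c x))"
    using False by (simp add: scale_seq_def mult.assoc[symmetric])
  also have "\<dots> \<le> inverse (norm c) * N (scale_seq c x)"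
    using N_scale_le[OF scale_in[OF assms]] by (metis norm_inverse)
  finally have "norm c * N x \<le> N (scale_seq c x)"
    using False by (simp add: field_simps)
  then show ?thesis using N_scale_le[OF assms, of c] by linarith
qed

lemma N_diff: "x \<in> X \<Longrightarrow> y \<in> X \<Longrightarrow> N (x - y) \<le> N x + N y"
  using N_add[of x "- y"] N_minus[of y] seq.subspace_neg[OF subspace, of y] by simp

lemma N_sum: "(\<And>i. i \<in> I \<Longrightarrow> f i \<in> X) \<Longrightarrow> N (sum f I) \<le> (\<Sum>i\<in>I. N (f i))"
proof (induction I rule: infinite_finite_induct)
  case (insert i I)
  have "N (sum f (insert i I)) = N (f i + sum f I)" by (simp only: sum.insert[OF insert.hyps])
  also have "\<dots> \<le> N (f i) + N (sum f I)" using insert by (intro N_add sum_in) auto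
  also have "\<dots> \<le> N (f i) + (\<Sum>i\<in>I. N (f i))" using insert by simp
  also have "\<dots> = (\<Sum>i\<in>insert i I. N (f i))" using insert by simp
  finally show ?case .
qed auto

lemma coord_le: assumes "x \<in> X" "1 \<le> k" shows "norm (x k) * u k \<le> N x"
proof -
  have "N (scale_seq (x k) (unit_seq k)) \<le> N x"
    by (rule solid) (use assms in \<open>auto simp: scale_seq_def unit_seq_def\<close>)
  then show ?thesis using assms by (simp add: N_scale unit_in N_unit)
qed

lemma eq_0: assumes "x \<in> X" "N x = 0" shows "x = 0"
proof
  fix k
  show "x k = 0 k"
  proof (cases "1 \<le> k")
    case True
    then show ?thesis using coord_le[OF assms(1) True] assms u_pos[OF True]
      by (simp add: mult_le_0_iff)
  next
    case False
    then show ?thesis using at_0[OF assms(1)] by (simp add: not_le)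
  qed
qed

section \<open>Metric topology, truncations and convergent series\<close>

sublocale Metric_space X "norm_dist X N"
  by (rule Metric_space_norm_dist) (use subspace N_nonneg eq_0 N_minus N_add in auto)

lemma mtopology_eq: "mtopology = norm_topology X N"
  by (simp add: norm_topology_def)

lemma norm_dist_eq: "x \<in> X \<Longrightarrow> y \<in> X \<Longrightarrow> norm_dist X N x y = N (x - y)"
  by (simp add: norm_dist_def)

lemma closed_limit:
  assumes "closedin mtopology C" "\<And>n. z n \<in> C" "x \<in> X" "(\<lambda>n. N (z n - x)) \<longlonglongrightarrow> 0"
  shows "x \<in> C"
proof -
  have zX: "z n \<in> X" for n using assms(1,2) closedin_subset[of mtopology C] by auto
  then have "limitin mtopology z x sequentially"
    unfolding limit_metric_sequentially
    using assms(3,4) by (auto simp: norm_dist_eq LIMSEQ_iff N_nonneg diff_in)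
  then show ?thesis
    by (rule limitin_closedin[OF _ assms(1)]) (use assms in auto)
qed

lemma finite_restrict:
  assumes "finite F" "F \<subseteq> {1..}"
  shows "restrict_seq F z \<in> X" "N (restrict_seq F z) \<le> (\<Sum>k\<in>F. norm (z k) * u k)"
proof -
  note restrict_seq_eq_sum[OF assms, of z]
  moreover have "scale_seq (z k) (unit_seq k) \<in> X" "N (scale_seq (z k) (unit_seq k)) = norm (z k) * u k"
    if "k \<in> F" for k
    using that assms by (auto simp: unit_in scale_in N_scale N_unit)
  ultimately show "restrict_seq F z \<in> X" "N (restrict_seq F z) \<le> (\<Sum>k\<in>F. norm (z k) * u k)"
    using N_sum[of F "\<lambda>k. scale_seq (z k) (unit_seq k)"] by (auto intro: sum_in)
qed

text \<open>Splitting off the tail beyond \<open>n\<close> costs only its norm, which tends to 0 by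
  \<open>tail\<close>. Norm estimates thus reduce to finitely many coordinates.\<close>

lemma N_le_truncations:
  assumes "x \<in> X" "\<And>n. N (restrict_seq {0<..n} x) \<le> K"
  shows "N x \<le> K"
proof -
  have "N x \<le> K + N (restrict_seq {n<..} x)" for n
  proof -
    have "x = restrict_seq {0<..n} x + restrict_seq {n<..} x"
      using at_0[OF assms(1)] by (auto simp: restrict_seq_def fun_eq_iff not_le)
    then have "N x \<le> N (restrict_seq {0<..n} x) + N (restrict_seq {n<..} x)"
      using N_add[OF restrict_in restrict_in, OF assms(1) assms(1)] by metis
    then show ?thesis using assms(2)[of n] by linarith
  qed
  moreover have "(\<lambda>n. K + N (restrict_seq {n<..} x)) \<longlonglongrightarrow> K + 0"
    by (intro tendsto_intros tail assms)
  ultimately show ?thesis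
    using LIMSEQ_le_const[of _ "K + 0" "N x"] by auto
qed

text \<open>On a finite index set coordinatewise convergence is norm convergence, so norm bounds
  survive it. Together with \<open>N_le_truncations\<close> this acts as a Fatou lemma.\<close>

lemma N_restrict_lim:
  assumes "finite F" "F \<subseteq> {1..}" "\<And>k. k \<in> F \<Longrightarrow> (\<lambda>i. z i k) \<longlonglongrightarrow> y k"
    and "\<And>i. N (restrict_seq F (z i)) \<le> K"
  shows "N (restrict_seq F y) \<le> K"
proof -
  have "N (restrict_seq F y) \<le> K + (\<Sum>k\<in>F. norm (y k - z i k) * u k)" for i
  proof -
    have "restrict_seq F y = restrict_seq F (z i) + restrict_seq F (y - z i)"
      by (auto simp: restrict_seq_def)
    then have "N (restrict_seq F y) \<le> N (restrict_seq F (z i)) + N (restrict_seq F (y - z i))"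
      using N_add[OF finite_restrict(1) finite_restrict(1)] assms(1,2) by metis
    then show ?thesis
      using finite_restrict(2)[OF assms(1,2), of "y - z i"] assms(4)[of i] by simp
  qed
  moreover have "(\<lambda>i. K + (\<Sum>k\<in>F. norm (y k - z i k) * u k)) \<longlonglongrightarrow> K + (\<Sum>k\<in>F. norm (y k - y k) * u k)"
    by (intro tendsto_intros assms(3))
  ultimately show ?thesis
    using LIMSEQ_le_const[of _ K] by auto
qed

text \<open>Completeness for series: the coordinates converge because \<open>coord_le\<close> bounds
  each coordinate functional, the norm bound on partial sums passes to finite restrictions of the
  remainder, and \<open>truncations_Cauchy\<close> puts the coordinatewise sum into
  \<open>X\<close>.\<close>

lemma series:
  fixes f :: "nat \<Rightarrow> nat \<Rightarrow> 'a"
  assumes f: "\<And>j. f j \<in> X" "\<And>j. N (f j) \<le> c j" and c: "summable c"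
  defines "x \<equiv> \<lambda>k. \<Sum>j. f j k"
  shows "x \<in> X" "N (x - (\<Sum>j<J. f j)) \<le> (\<Sum>j. c (j + J))"
proof -
  have c0: "0 \<le> c j" for j using f[of j] N_nonneg order_trans by blast
  have sm: "summable (\<lambda>j. f j k)" for k
  proof (cases "1 \<le> k")
    case True
    show ?thesis
    proof (rule summable_comparison_test')
      show "summable (\<lambda>j. c j / u k)" using c by (rule summable_divide)
      show "norm (f j k) \<le> c j / u k" for j
        using coord_le[OF f(1)[of j] True] f(2)[of j] u_pos[OF True] by (simp add: field_simps)
    qed
  next
    case False
    then show ?thesis using at_0[OF f(1)] by (simp add: not_le)
  qed
  have part: "N (\<Sum>j<i. f (j + J)) \<le> (\<Sum>j. c (j + J))" for i J
  proof -
    have "N (\<Sum>j<i. f (j + J)) \<le> (\<Sum>j<i. N (f (j + J)))" by (rule N_sum) (rule f)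
    also have "\<dots> \<le> (\<Sum>j<i. c (j + J))" by (intro sum_mono f)
    also have "\<dots> \<le> (\<Sum>j. c (j + J))"
      using c c0 by (intro sum_le_suminf) (auto simp: summable_iff_shift)
    finally show ?thesis .
  qed
  have lim: "(\<lambda>i. (\<Sum>j<i. f (j + J)) k) \<longlonglongrightarrow> (x - (\<Sum>j<J. f j)) k" for J k
  proof -
    have "(\<lambda>j. f (j + J) k) sums (x k - (\<Sum>j<J. f j k))"
      unfolding x_def by (intro sums_split_initial_segment summable_sums sm)
    then show ?thesis by (simp add: sums_def sum_fun_apply)
  qed
  have fin: "N (restrict_seq F (x - (\<Sum>j<J. f j))) \<le> (\<Sum>j. c (j + J))"
    if "finite F" "F \<subseteq> {1..}" for F J
  proof (rule N_restrict_lim[OF that lim])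
    show "N (restrict_seq F (\<Sum>j<i. f (j + J))) \<le> (\<Sum>j. c (j + J))" for i
      by (rule order_trans[OF N_restrict part]) (auto intro: sum_in f)
  qed
  show x: "x \<in> X"
  proof (rule truncations_Cauchy)
    show "x 0 = 0" using at_0[OF f(1)] by (simp add: x_def)
    fix e :: real assume e: "0 < e"
    \<comment> \<open>First \<open>J\<close> makes the remainder of the series small, then
      \<open>n\<close> makes the tail of the first \<open>J\<close> terms small.\<close>
    have "(\<lambda>J. \<Sum>j. c (j + J)) \<longlonglongrightarrow> 0" using suminf_exist_split2[OF c] .
    then obtain J where J: "(\<Sum>j. c (j + J)) < e / 2"
      using eventually_happens'[OF sequentially_bot order_tendstoD(2)[of _ 0 sequentially "e/2"]] e by auto
    have sX: "(\<Sum>j<J. f j) \<in> X" by (intro sum_in f)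
    obtain n where n: "N (restrict_seq {n<..} (\<Sum>j<J. f j)) < e / 2"
      using eventually_happens'[OF sequentially_bot order_tendstoD(2)[OF tail[OF sX], of "e/2"]] e by auto
    have "N (restrict_seq {n<..m} x) \<le> e" for m
    proof -
      have "restrict_seq {n<..m} x = restrict_seq {n<..m} (x - (\<Sum>j<J. f j)) + restrict_seq {n<..m} (\<Sum>j<J. f j)"
        by (auto simp: restrict_seq_def)
      moreover have "restrict_seq {n<..m} (x - (\<Sum>j<J. f j)) \<in> X"
        by (intro finite_restrict) auto
      ultimately have "N (restrict_seq {n<..m} x) \<le> N (restrict_seq {n<..m} (x - (\<Sum>j<J. f j))) + N (restrict_seq {n<..m} (\<Sum>j<J. f j))"
        using N_add restrict_in[OF sX] by metis
      also have "\<dots> \<le> e / 2 + e / 2"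
      proof (rule add_mono)
        show "N (restrict_seq {n<..m} (x - (\<Sum>j<J. f j))) \<le> e / 2"
          using order_trans[OF fin[of "{n<..m}" J] less_imp_le[OF J]] by fastforce
        have "restrict_seq {n<..m} (\<Sum>j<J. f j) = restrict_seq {n<..m} (restrict_seq {n<..} (\<Sum>j<J. f j))"
          by (auto simp: restrict_seq_def)
        then have "N (restrict_seq {n<..m} (\<Sum>j<J. f j)) \<le> N (restrict_seq {n<..} (\<Sum>j<J. f j))"
          using N_restrict[OF restrict_in[OF sX]] by metis
        then show "N (restrict_seq {n<..m} (\<Sum>j<J. f j)) \<le> e / 2" using n by linarith
      qed
      finally show ?thesis by simp
    qed
    then show "\<exists>n. \<forall>m. N (restrict_seq {n<..m} x) \<le> e" by blast
  qed
  show "N (x - (\<Sum>j<J. f j)) \<le> (\<Sum>j. c (j + J))"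
    by (rule N_le_truncations) (auto intro!: diff_in x sum_in f fin)
qed

end

section \<open>Weighted shifts\<close>

locale weighted_shift_space = weighted_seq_space X N u
  for X :: "(nat \<Rightarrow> 'a::{real_normed_field,banach,second_countable_topology}) set"
    and N :: "(nat \<Rightarrow> 'a) \<Rightarrow> real" and u :: "nat \<Rightarrow> real" +
  fixes w :: "nat \<Rightarrow> 'a" and B :: "(nat \<Rightarrow> 'a) \<Rightarrow> (nat \<Rightarrow> 'a)"
  assumes shift: "weighted_shift (norm_topology X N) w B"
begin

text \<open>For \<open>1 \<le> k\<close> this is the \<open>A n k\<close> of the overview:
  \<open>B ^^ n\<close> sends the unit sequence at \<open>k + n\<close>, of norm
  \<open>u (k + n)\<close>, to a multiple of the one at \<open>k\<close>, whose norm is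
  \<open>u k\<close>.\<close>

definition growth :: "nat \<Rightarrow> nat \<Rightarrow> real" where
  "growth n k = (\<Prod>\<nu>=1..n. norm (w (\<nu> + k))) * (u k / u (k + n))"

lemma w_nonzero: "1 \<le> n \<Longrightarrow> w n \<noteq> 0"
  using shift by (auto simp: weighted_shift_def)

lemma topspace_eq: "topspace (norm_topology X N) = X"
  by (simp flip: mtopology_eq)

lemma B_cont: "continuous_map mtopology mtopology B"
  using shift by (auto simp: weighted_shift_def mtopology_eq)

lemma B_in: "x \<in> X \<Longrightarrow> B x \<in> X"
  using B_cont by (auto simp: continuous_map_def)

lemma B_add: "x \<in> X \<Longrightarrow> y \<in> X \<Longrightarrow> B (x + y) = B x + B y"
  and B_scale: "x \<in> X \<Longrightarrow> B (scale_seq c x) = scale_seq c (B x)"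
  and B_unit: "1 \<le> n \<Longrightarrow> B (unit_seq n) = scale_seq (w n) (unit_seq (n - 1))"
  using shift by (auto simp: weighted_shift_def topspace_eq)

lemma B_0: "B 0 = 0"
  using B_scale[OF zero_in, of 0] by (simp add: scale_seq_def zero_fun_def)

lemma B_sum: "(\<And>i. i \<in> I \<Longrightarrow> f i \<in> X) \<Longrightarrow> B (sum f I) = (\<Sum>i\<in>I. B (f i))"
proof (induction I rule: infinite_finite_induct)
  case (insert i I)
  have "B (sum f (insert i I)) = B (f i + sum f I)"
    by (simp only: sum.insert[OF insert.hyps])
  also have "\<dots> = B (f i) + B (sum f I)"
    using insert by (intro B_add sum_in) auto
  also have "\<dots> = B (f i) + (\<Sum>i\<in>I. B (f i))"
    using insert by simp
  finally show ?case by (simp only: sum.insert[OF insert.hyps])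
qed (auto simp: B_0)

lemma B_small:
  assumes "0 < e"
  obtains r where "0 < r" "\<And>x. x \<in> X \<Longrightarrow> N x < r \<Longrightarrow> N (B x) < e"
proof -
  have "openin mtopology {x \<in> X. B x \<in> mball 0 e}"
    using openin_continuous_map_preimage[OF B_cont openin_mball, of 0 e] by simp
  moreover have "0 \<in> {x \<in> X. B x \<in> mball 0 e}"
    using assms zero_in by (simp add: B_0)
  ultimately obtain r where r: "0 < r" "mball 0 r \<subseteq> {x \<in> X. B x \<in> mball 0 e}"
    unfolding openin_mtopology by blast
  show ?thesis
  proof
    fix x assume x: "x \<in> X" "N x < r"
    then have "x \<in> mball 0 r"
      using zero_in N_minus[of x] by (simp add: norm_dist_eq)
    then have "B x \<in> mball 0 e" using r by blast
    then show "N (B x) < e"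
      using zero_in N_minus[of "B x"] by (auto simp: norm_dist_eq)
  qed (fact r)
qed

lemma B_restrict_coord:
  assumes "1 \<le> k" "k < n"
  shows "B (restrict_seq {0<..n} x) k = w (k + 1) * x (k + 1)"
proof -
  have F: "finite {0<..n}" "{0<..n} \<subseteq> {1..}" by auto
  have "B (restrict_seq {0<..n} x) = (\<Sum>j\<in>{0<..n}. B (scale_seq (x j) (unit_seq j)))"
    unfolding restrict_seq_eq_sum[OF F] by (intro B_sum scale_in unit_in) auto
  also have "\<dots> = (\<Sum>j\<in>{0<..n}. scale_seq (x j) (scale_seq (w j) (unit_seq (j - 1))))"
    by (intro sum.cong refl) (simp add: B_scale unit_in B_unit)
  finally have "B (restrict_seq {0<..n} x) k
      = (\<Sum>j\<in>{0<..n}. scale_seq (x j) (scale_seq (w j) (unit_seq (j - 1))) k)"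
    by (simp only: sum_fun_apply)
  also have "\<dots> = (\<Sum>j\<in>{0<..n}. if j = k + 1 then x j * w j else 0)"
    using assms by (intro sum.cong refl) (auto simp: scale_seq_def unit_seq_def)
  finally have "B (restrict_seq {0<..n} x) k = (\<Sum>j\<in>{0<..n}. if j = k + 1 then x j * w j else 0)" .
  then show ?thesis using assms by (simp add: mult.commute)
qed

text \<open>\<open>B\<close> is prescribed only on unit sequences. Linearity settles truncations;
  the image of the tail is arbitrarily small by continuity at 0, hence so is its \<open>k\<close>-th
  coordinate.\<close>

lemma B_coord:
  assumes x: "x \<in> X" and k: "1 \<le> k"
  shows "B x k = w (k + 1) * x (k + 1)"
proof -
  let ?d = "norm (B x k - w (k + 1) * x (k + 1)) * u k"
  have "?d \<le> e" if e: "0 < e" for e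
  proof -
    obtain r where r: "0 < r" "\<And>x. x \<in> X \<Longrightarrow> N x < r \<Longrightarrow> N (B x) < e"
      using B_small[OF e] by metis
    have "\<forall>\<^sub>F n in sequentially. N (restrict_seq {n<..} x) < r \<and> k < n"
      using order_tendstoD(2)[OF tail[OF x] r(1)] eventually_gt_at_top by (rule eventually_conj)
    then obtain n where n: "N (restrict_seq {n<..} x) < r" "k < n"
      using eventually_happens'[OF sequentially_bot] by blast
    have "x = restrict_seq {0<..n} x + restrict_seq {n<..} x"
      using at_0[OF x] by (auto simp: restrict_seq_def fun_eq_iff not_le)
    then have "B x k = B (restrict_seq {0<..n} x) k + B (restrict_seq {n<..} x) k"
      using B_add[OF restrict_in restrict_in, OF x x] by (metis plus_fun_apply)
    then have "?d = norm (B (restrict_seq {n<..} x) k) * u k"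
      using B_restrict_coord[OF k n(2)] by simp
    also have "\<dots> \<le> N (B (restrict_seq {n<..} x))"
      by (intro coord_le B_in restrict_in x k)
    also have "\<dots> < e" by (intro r n restrict_in x)
    finally show ?thesis by simp
  qed
  then have "?d \<le> 0" by (rule field_le_epsilon[of _ 0, simplified])
  then show ?thesis using u_pos[OF k] by (simp add: mult_le_0_iff)
qed

lemma B_iter_in: "x \<in> X \<Longrightarrow> (B ^^ n) x \<in> X"
  by (induction n) (auto intro: B_in)

lemma B_iter_coord:
  assumes "x \<in> X" "1 \<le> k"
  shows "(B ^^ n) x k = (\<Prod>\<nu>=1..n. w (\<nu> + k)) * x (k + n)"
  using assms
proof (induction n arbitrary: x)
  case (Suc n)
  have "(B ^^ Suc n) x k = (B ^^ n) (B x) k" by (simp only: funpow_Suc_right o_apply)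
  also have "\<dots> = (\<Prod>\<nu>=1..n. w (\<nu> + k)) * B x (k + n)"
    using Suc B_in by blast
  also have "B x (k + n) = w (k + n + 1) * x (k + n + 1)"
    using Suc.prems by (intro B_coord) auto
  finally show ?case by (simp add: ac_simps)
qed simp

section \<open>Growth factors of the iterates\<close>

lemma growth_pos: "1 \<le> k \<Longrightarrow> 0 < growth n k"
  using u_pos[of k] u_pos[of "k + n"] w_nonzero
  by (auto simp: growth_def intro!: mult_pos_pos prod_pos divide_pos_pos)

lemma growth_0: "1 \<le> k \<Longrightarrow> growth 0 k = 1"
  using u_pos[of k] by (simp add: growth_def)

lemma growth_Suc: "1 \<le> k \<Longrightarrow> growth (Suc n) k = growth n k * growth 1 (k + n)"
  using u_pos[of "k + n"] by (simp add: growth_def ac_simps)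

lemma growth_add: "1 \<le> k \<Longrightarrow> growth (n + l) k = growth n k * growth l (k + n)"
proof (induction l)
  case (Suc l)
  have "growth (n + Suc l) k = growth (n + l) k * growth 1 (k + (n + l))"
    using growth_Suc[OF Suc.prems, of "n + l"] by simp
  also have "\<dots> = growth n k * (growth l (k + n) * growth 1 (k + n + l))"
    using Suc by (simp add: ac_simps)
  also have "\<dots> = growth n k * growth (Suc l) (k + n)"
    using growth_Suc[of "k + n" l] Suc.prems by simp
  finally show ?case .
qed (simp add: growth_0)

text \<open>In the normalised coordinates \<open>norm (x k) * u k\<close> the iterates are shifts
  with factors \<open>growth n k\<close>; this is the form in which \<open>dominated\<close>
  compares norms.\<close>

lemma norm_B_iter:
  assumes "x \<in> X" "1 \<le> k"
  shows "norm ((B ^^ n) x k) * u k = growth n k * (norm (x (k + n)) * u (k + n))"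
  using u_pos[of "k + n"] assms
  by (simp add: B_iter_coord growth_def norm_mult prod_norm)

lemma growth_bound:
  obtains C where "1 \<le> C" "\<And>n k. 1 \<le> k \<Longrightarrow> growth n k \<le> C ^ n"
proof -
  obtain r where r: "0 < r" "\<And>x. x \<in> X \<Longrightarrow> N x < r \<Longrightarrow> N (B x) < 1"
    using B_small[of 1] by auto
  have g1: "growth 1 k \<le> 2 / r" if k: "1 \<le> k" for k
  proof -
    \<comment> \<open>A multiple of the unit sequence with norm \<open>r / 2\<close>, hence in the
      ball that \<open>B\<close> maps into the unit ball; this gives the constant
      \<open>2 / r\<close>.\<close>
    define x where "x = scale_seq (of_real (r / (2 * u (k + 1)))) (unit_seq (k + 1) :: nat \<Rightarrow> 'a)"
    have uk: "0 < u (k + 1)" by (rule u_pos) simp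
    have x: "x \<in> X" "N x = r / 2"
      using uk r(1) by (auto simp: x_def scale_in unit_in N_scale N_unit norm_divide norm_mult)
    have "norm (x (k + 1)) * u (k + 1) = r / 2"
      using uk r(1) by (simp add: x_def scale_seq_def unit_seq_def norm_divide norm_mult)
    then have "growth 1 k * (r / 2) = norm (B x k) * u k"
      using norm_B_iter[OF x(1) k, of 1] by simp
    also have "\<dots> \<le> N (B x)" by (intro coord_le B_in x k)
    also have "\<dots> \<le> 1" using r x by (simp add: less_imp_le)
    finally show ?thesis using r(1) by (simp add: field_simps)
  qed
  show ?thesis
  proof
    show "1 \<le> max 1 (2 / r)" by simp
    show "growth n k \<le> max 1 (2 / r) ^ n" if k: "1 \<le> k" for n k
    proof (induction n)
      case (Suc n)
      have "growth n k * growth 1 (k + n) \<le> max 1 (2 / r) ^ n * max 1 (2 / r)"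
        using Suc g1[of "k + n"] growth_pos[of "k + n" 1] k by (intro mult_mono) (auto simp: le_max_iff_disj)
      then show ?case using growth_Suc[OF k, of n] by (simp add: mult.commute)
    qed (use growth_0[OF k] in simp)
  qed
qed

lemma hypercyclic_vector_iff:
  "hypercyclic_vector (norm_topology X N) B x \<longleftrightarrow>
     x \<in> X \<and> (\<forall>z\<in>X. \<forall>e>0. \<exists>n\<ge>1. N ((B ^^ n) x - z) < e)"
proof -
  have "z \<in> mtopology closure_of {(B ^^ n) x | n. 1 \<le> n} \<longleftrightarrow>
      z \<in> X \<and> (\<forall>e>0. \<exists>n\<ge>1. N ((B ^^ n) x - z) < e)" if x: "x \<in> X" for z
  proof (cases "z \<in> X")
    case True
    have "(B ^^ n) x \<in> mball z e \<longleftrightarrow> N ((B ^^ n) x - z) < e" for n e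
      using True B_iter_in[OF x, of n] commute[of z]
      by (simp add: norm_dist_eq)
    then show ?thesis
      using True unfolding metric_closure_of mem_Collect_eq by blast
  next
    case False
    then show ?thesis unfolding metric_closure_of by auto
  qed
  then show ?thesis
    unfolding hypercyclic_vector_def mtopology_eq[symmetric] by (auto simp: set_eq_iff)
qed

end

section \<open>Expanding shifts have no hypercyclic subspace\<close>

text \<open>One more linear condition lowers the dimension by at most one: if some \<open>g\<close>
  in the space has \<open>g n \<noteq> 0\<close>, subtracting multiples of \<open>g\<close> clears
  coordinate \<open>n\<close>, so a finite spanning set after the step yields one before it by
  adding \<open>g\<close>.\<close>

lemma not_finite_span_vanishing:
  fixes M :: "(nat \<Rightarrow> 'a::field) set"
  assumes M: "seq.subspace M" "\<not> (\<exists>S. finite S \<and> M = seq.span S)"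
  shows "\<not> (\<exists>S. finite S \<and> {f \<in> M. \<forall>k<n. f k = 0} = seq.span S)"
proof (induction n)
  case 0
  then show ?case using M(2) by simp
next
  case (Suc n)
  let ?V = "\<lambda>n. {f \<in> M. \<forall>k<n. f k = 0}"
  show ?case
  proof
    assume "\<exists>S. finite S \<and> ?V (Suc n) = seq.span S"
    then obtain S where S: "finite S" "?V (Suc n) = seq.span S" by blast
    show False
    proof (cases "\<forall>f\<in>?V n. f n = 0")
      case True
      then have "?V n = ?V (Suc n)" by (auto simp: less_Suc_eq)
      then show False using Suc S by metis
    next
      case False
      then obtain g where g: "g \<in> ?V n" "g n \<noteq> 0" by blast
      have "?V n = seq.span (insert g S)"
      proof (intro set_eqI iffI)
        fix f assume f: "f \<in> ?V n"
        have "f - scale_seq (f n / g n) g \<in> ?V (Suc n)"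
        proof -
          have "f - scale_seq (f n / g n) g \<in> M"
            using f g M(1) by (blast intro: seq.subspace_diff seq.subspace_scale)
          then show ?thesis using f g by (auto simp: scale_seq_def less_Suc_eq)
        qed
        then show "f \<in> seq.span (insert g S)" using S by (auto simp: seq.span_breakdown_eq)
      next
        fix f assume "f \<in> seq.span (insert g S)"
        then obtain c where c: "f - scale_seq c g \<in> ?V (Suc n)"
          using S by (auto simp: seq.span_breakdown_eq)
        have "f = (f - scale_seq c g) + scale_seq c g" by simp
        moreover have "(f - scale_seq c g) + scale_seq c g \<in> M"
          using c g M(1) by (blast intro: seq.subspace_add seq.subspace_scale)
        ultimately have "f \<in> M" by metis
        moreover have "f k = 0" if "k < n" for k
        proof -
          have "(f - scale_seq c g) k = 0" "g k = 0" using c g that by auto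
          then show ?thesis by (simp add: scale_seq_def)
        qed
        ultimately show "f \<in> ?V n" by blast
      qed
      then show False using Suc S(1) by blast
    qed
  qed
qed

lemma exists_nonzero_vanishing:
  fixes M :: "(nat \<Rightarrow> 'a::field) set"
  assumes "seq.subspace M" "\<not> (\<exists>S. finite S \<and> M = seq.span S)"
  obtains f where "f \<in> M" "f \<noteq> 0" "\<And>k. k \<le> n \<Longrightarrow> f k = 0"
proof -
  let ?V = "{f \<in> M. \<forall>k<Suc n. f k = 0}"
  have "0 \<in> ?V" using assms by (simp add: seq.subspace_0)
  moreover have "?V \<noteq> {0}"
    using not_finite_span_vanishing[OF assms, of "Suc n"] seq.span_empty by (metis finite.emptyI)
  ultimately obtain f where "f \<in> ?V" "f \<noteq> 0" by blast
  then show ?thesis using that[of f] by (simp add: less_Suc_eq_le)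
qed

context weighted_shift_space
begin

lemma N_B_iter_le:
  assumes "\<And>n k. 1 \<le> k \<Longrightarrow> growth n k \<le> C ^ n" "1 \<le> C" and y: "y \<in> X"
  shows "N ((B ^^ l) y) \<le> C ^ l * N y"
proof -
  have "(B ^^ l) y \<in> X \<and> N ((B ^^ l) y) \<le> N (scale_seq (of_real (C ^ l)) y)"
  proof (rule dominated[where S = "{1..}" and \<sigma> = "\<lambda>k. k + l"])
    show "norm ((B ^^ l) y k) * u k \<le> norm (scale_seq (of_real (C ^ l)) y (k + l)) * u (k + l)"
      if "k \<in> {1..}" for k
    proof -
      have "growth l k * (norm (y (k + l)) * u (k + l)) \<le> C ^ l * (norm (y (k + l)) * u (k + l))"
        using that assms(1)[of k l] u_pos[of "k + l"] by (intro mult_right_mono) auto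
      then show ?thesis using norm_B_iter[OF y, of k l] that assms(2)
        by (simp add: scale_seq_def norm_mult norm_power mult.assoc)
    qed
    show "(B ^^ l) y k = 0" if "k \<notin> {1..}" for k
      using at_0[OF B_iter_in[OF y]] that by (simp add: not_le)
  qed (use y in \<open>auto intro: scale_in\<close>)
  then show ?thesis using assms(2) by (simp add: N_scale y norm_power)
qed

lemma growth_power:
  assumes "\<And>k. 1 \<le> k \<Longrightarrow> d \<le> growth n k" "0 \<le> d" "1 \<le> k"
  shows "d ^ m \<le> growth (n * m) k"
  using assms(3)
proof (induction m)
  case (Suc m)
  have "d ^ m * d \<le> growth (n * m) k * growth n (k + n * m)"
    using Suc assms(1)[of "k + n * m"] assms(2) growth_pos[of k]
    by (intro mult_mono) (auto simp: less_imp_le)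
  then show ?case using growth_add[OF Suc.prems, of "n * m" n] by (simp add: ac_simps)
qed (use growth_0[of k] in simp)

text \<open>Dominance is used backwards: coordinate \<open>k\<close> of the tail is compared with
  coordinate \<open>k - l\<close> of the iterate. The shift destroys the first \<open>l\<close>
  coordinates, so only the tail beyond \<open>l\<close> can be estimated.\<close>

lemma N_B_iter_ge:
  assumes "\<And>k. 1 \<le> k \<Longrightarrow> d \<le> growth l k" "0 \<le> d" and x: "x \<in> X"
  shows "d * N (restrict_seq {l<..} x) \<le> N ((B ^^ l) x)"
proof -
  let ?z = "scale_seq (of_real d) (restrict_seq {l<..} x)"
  have "?z \<in> X \<and> N ?z \<le> N ((B ^^ l) x)"
  proof (rule dominated[where S = "{l<..}" and \<sigma> = "\<lambda>k. k - l"])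
    show "norm (?z k) * u k \<le> norm ((B ^^ l) x (k - l)) * u (k - l)" if "k \<in> {l<..}" for k
    proof -
      have "d * (norm (x k) * u k) \<le> growth l (k - l) * (norm (x k) * u k)"
        using that assms(1)[of "k - l"] u_pos[of k] by (intro mult_right_mono) auto
      then show ?thesis using norm_B_iter[OF x, of "k - l" l] that assms(2)
        by (simp add: scale_seq_def restrict_seq_def norm_mult mult.assoc)
    qed
    show "?z k = 0" if "k \<notin> {l<..}" for k
      using that by (simp add: scale_seq_def restrict_seq_def)
    show "inj_on (\<lambda>k. k - l) {l<..}" by (auto simp: inj_on_def)
  qed (auto intro!: B_iter_in x)
  then show ?thesis using assms(2) by (simp add: N_scale restrict_in x)
qed

text \<open>The difference of \<open>a + b\<close> and \<open>a - b\<close> is twice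
  \<open>b\<close>, so they cannot both have norm below \<open>N b\<close>, however \<open>a\<close>
  and \<open>b\<close> overlap.\<close>

lemma N_add_or_diff:
  assumes "a \<in> X" "b \<in> X"
  shows "N b \<le> N (a + b) \<or> N b \<le> N (a - b)"
proof -
  have "N ((a + b) - (a - b)) \<le> N (a + b) + N (a - b)"
    using assms by (intro N_diff add_in diff_in)
  moreover have "(a + b) - (a - b) = scale_seq 2 b"
    by (auto simp: scale_seq_def)
  ultimately show ?thesis by (simp add: N_scale assms) linarith
qed

text \<open>
  Gliding hump: unit vectors \<open>f j\<close> of \<open>M\<close> supported beyond \<open>r j\<close> are summed with coefficients
  \<open>\<plusminus> 4\<^sup>-\<^sup>j\<close>.  By \<open>N_add_or_diff\<close> the signs can be chosen so that the tail of the partial sum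
  beyond \<open>r j\<close> is at least \<open>4\<^sup>-\<^sup>j\<close>, and the remaining terms cannot destroy more than a third of it.
\<close>

lemma exists_slowly_decaying:
  assumes M: "closedin mtopology M" "seq.subspace M" "\<not> (\<exists>S. finite S \<and> M = seq.span S)"
  obtains x where "x \<in> M" "\<And>j. (1/2) * (1/4) ^ j \<le> N (restrict_seq {r j<..} x)"
proof -
  have MX: "M \<subseteq> X" using closedin_subset[OF M(1)] by simp
  have "\<exists>f\<in>M. N f = 1 \<and> (\<forall>k\<le>r j. f k = 0)" for j
  proof -
    obtain f where f: "f \<in> M" "f \<noteq> 0" "\<And>k. k \<le> r j \<Longrightarrow> f k = 0"
      using exists_nonzero_vanishing[OF M(2,3)] by metis
    have "0 < N f" using f MX N_nonneg[of f] eq_0[of f] by fastforce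
    moreover have "f \<in> X" using f MX by auto
    ultimately have "N (scale_seq (of_real (1 / N f)) f) = 1"
      by (simp add: N_scale norm_divide)
    moreover have "scale_seq (of_real (1 / N f)) f \<in> M" using M(2) f by (simp add: seq.subspace_scale)
    moreover have "\<forall>k\<le>r j. scale_seq (of_real (1 / N f)) f k = 0" using f by (simp add: scale_seq_def)
    ultimately show ?thesis by blast
  qed
  then obtain f where f: "\<And>j. f j \<in> M" "\<And>j. N (f j) = 1" "\<And>j k. k \<le> r j \<Longrightarrow> f j k = 0"
    by metis
  define g where "g j = scale_seq (of_real ((1/4) ^ j)) (f j)" for j
  have g: "g j \<in> M" "g j \<in> X" "N (g j) = (1/4) ^ j" "restrict_seq {r j<..} (g j) = g j" for j
  proof -
    have fX: "f j \<in> X" using f MX by auto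
    show "g j \<in> M" using f M(2) by (simp only: g_def seq.subspace_scale)
    then show "g j \<in> X" using MX by auto
    show "N (g j) = (1/4) ^ j"
      unfolding g_def N_scale[OF fX] f by (simp add: norm_power norm_divide)
    show "restrict_seq {r j<..} (g j) = g j"
      using f(3) by (auto simp: g_def restrict_seq_def scale_seq_def fun_eq_iff not_less)
  qed
  \<comment> \<open>The clause for \<open>j = 0\<close> starts the partial sums at 0, so that the
    telescoping sum of the increments \<open>h\<close> is \<open>s J\<close> itself.\<close>
  let ?P = "\<lambda>j s. s \<in> M \<and> (j = 0 \<longrightarrow> s = 0)"
  let ?Q = "\<lambda>j s s'. (s' = s + g j \<or> s' = s - g j) \<and> (1/4) ^ j \<le> N (restrict_seq {r j<..} s')"
  have "\<exists>s. \<forall>j. ?P j (s j) \<and> ?Q j (s j) (s (Suc j))"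
  proof (rule dependent_nat_choice[of ?P ?Q])
    show "\<exists>s. ?P 0 s" using M(2) by (auto simp: seq.subspace_0)
    fix s and j :: nat assume "?P j s"
    then have s: "s \<in> M" "s \<in> X" using MX by auto
    have "N (g j) \<le> N (restrict_seq {r j<..} s + g j) \<or> N (g j) \<le> N (restrict_seq {r j<..} s - g j)"
      by (intro N_add_or_diff restrict_in s g)
    then have "?Q j s (s + g j) \<or> ?Q j s (s - g j)"
      by (simp add: restrict_seq_simps g)
    moreover have "s + g j \<in> M" "s - g j \<in> M"
      using s g M(2) by (auto intro: seq.subspace_add seq.subspace_diff)
    ultimately show "\<exists>s'. ?P (Suc j) s' \<and> ?Q j s s'" by blast
  qed
  then obtain s where s: "\<And>j. s j \<in> M" "s 0 = 0" "\<And>j. ?Q j (s j) (s (Suc j))" by auto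
  have sX: "s j \<in> X" for j using s MX by auto
  define h where "h j = s (Suc j) - s j" for j
  have "h j = g j \<or> h j = - g j" for j using s(3)[of j] by (auto simp: h_def)
  then have h: "h j \<in> X" "N (h j) \<le> (1/4) ^ j" for j
    using sX N_minus[of "g j"] g(3)[of j] by (auto simp: h_def diff_in) (metis order_refl)+
  have sum_h: "(\<Sum>j<J. h j) = s J" for J
    unfolding h_def by (subst sum_lessThan_telescope) (simp add: s)
  define x where "x k = (\<Sum>j. h j k)" for k
  have geo: "summable (\<lambda>j. (1/4::real) ^ j)" by (rule summable_geometric) simp
  have geo_tail: "(\<Sum>j. (1/4::real) ^ (j + J)) = (4/3) * (1/4) ^ J" for J
    using suminf_mult2[OF geo, of "(1/4) ^ J"] by (simp add: power_add suminf_geometric)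
  have x: "x \<in> X" "N (x - s J) \<le> (4/3) * (1/4) ^ J" for J
    using series[of h "\<lambda>j. (1/4) ^ j", OF h geo] unfolding sum_h x_def[abs_def] geo_tail by blast+
  show ?thesis
  proof
    show "x \<in> M"
    proof (rule closed_limit[OF M(1) s(1) x(1)])
      have "(\<lambda>J. (4/3) * (1/4::real) ^ J) \<longlonglongrightarrow> (4/3) * 0"
        by (intro tendsto_intros LIMSEQ_realpow_zero) auto
      moreover have "0 \<le> N (s J - x)" "N (s J - x) \<le> (4/3) * (1/4::real) ^ J" for J
        using N_nonneg[OF diff_in[OF sX x(1)], of J] x(2)[of J] N_minus[of "x - s J"] by auto
      ultimately show "(\<lambda>J. N (s J - x)) \<longlonglongrightarrow> 0"
        by (intro tendsto_sandwich[of "\<lambda>_. 0" "\<lambda>J. N (s J - x)" _ "\<lambda>J. (4/3) * (1/4::real) ^ J"]) auto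
    qed
    show "(1/2) * (1/4) ^ j \<le> N (restrict_seq {r j<..} x)" for j
    proof -
      let ?R = "restrict_seq {r j<..}"
      have "?R (s (Suc j)) = ?R x - ?R (x - s (Suc j))" by (simp add: restrict_seq_simps)
      then have "N (?R (s (Suc j))) \<le> N (?R x) + N (?R (x - s (Suc j)))"
        using N_diff[OF restrict_in restrict_in, of x "x - s (Suc j)" "{r j<..}" "{r j<..}"] x(1) sX
        by (simp add: diff_in)
      \<comment> \<open>This bound is a third of \<open>(1/4) ^ j\<close>; two thirds remain, more
        than the claimed half.\<close>
      also have "N (?R (x - s (Suc j))) \<le> (4/3) * (1/4) ^ Suc j"
        using N_restrict[OF diff_in[OF x(1) sX]] x(2)[of "Suc j"] by (rule order_trans)
      finally show ?thesis
        using conjunct2[OF s(3)[of j]] zero_le_power[of "1/4::real" j] unfolding power_Suc by linarith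
    qed
  qed
qed

lemma no_hypercyclic_subspace:
  assumes d: "1 < d" "1 \<le> n" "\<And>k. 1 \<le> k \<Longrightarrow> d \<le> growth n k"
  shows "\<not> hypercyclic_subspace (norm_topology X N) B M"
proof
  assume H: "hypercyclic_subspace (norm_topology X N) B M"
  then have M: "closedin mtopology M" "seq.subspace M" "\<not> (\<exists>S. finite S \<and> M = seq.span S)"
    by (auto simp: hypercyclic_subspace_def mtopology_eq)
  obtain C where C: "1 \<le> C" "\<And>n k. 1 \<le> k \<Longrightarrow> growth n k \<le> C ^ n"
    using growth_bound by metis
  \<comment> \<open>Over \<open>L\<close> applications of \<open>B ^^ n\<close> the expansion
    exceeds 4 and so beats the decay rate \<open>1/4\<close> provided by
    \<open>exists_slowly_decaying\<close>.\<close>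
  obtain L where L: "4 < d ^ L" using real_arch_pow[OF d(1)] by blast
  then have L0: "0 < L" by (cases L) auto
  obtain x where x: "x \<in> M" "\<And>j. (1/2) * (1/4) ^ j \<le> N (restrict_seq {L * n * (j + 1)<..} x)"
    using exists_slowly_decaying[OF M, of "\<lambda>j. L * n * (j + 1)"] by metis
  have xX: "x \<in> X" using x closedin_subset[OF M(1)] by auto
  have "x \<noteq> 0"
  proof
    assume "x = 0"
    then have "restrict_seq F x = 0" for F by (simp add: restrict_seq_def fun_eq_iff)
    then show False using x(2)[of 0] by simp
  qed
  then have hyp: "hypercyclic_vector (norm_topology X N) B x"
    using H x by (auto simp: hypercyclic_subspace_def)
  \<comment> \<open>With \<open>j = m div L\<close>, the expansion is at least \<open>d ^ m\<close>,
    hence at least \<open>4 ^ j\<close>, and the tail beyond \<open>n * m\<close> contains the one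
    beyond \<open>L * n * (j + 1)\<close>, whose norm is at least half of
    \<open>(1/4) ^ j\<close>.\<close>
  have low: "1/2 \<le> N ((B ^^ (n * m)) x)" for m
  proof -
    define j where "j = m div L"
    have mj: "L * j \<le> m" "m < L * (j + 1)"
      using L0 by (auto simp: j_def dividend_less_times_div)
    have "4 ^ j \<le> (d ^ L) ^ j" using L by (intro power_mono) auto
    also have "\<dots> \<le> d ^ m" using mj d by (simp flip: power_mult)
    finally have "4 ^ j * ((1/2) * (1/4) ^ j) \<le> d ^ m * N (restrict_seq {L * n * (j + 1)<..} x)"
      using x(2)[of j] d by (intro mult_mono) auto
    also have "\<dots> \<le> d ^ m * N (restrict_seq {n * m<..} x)"
    proof (intro mult_left_mono)
      have "n * m \<le> L * n * (j + 1)" using mult_le_mono2[OF less_imp_le[OF mj(2)], of n] by (simp only: ac_simps)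
      then have "restrict_seq {L * n * (j + 1)<..} x
          = restrict_seq {L * n * (j + 1)<..} (restrict_seq {n * m<..} x)"
        by (auto simp: restrict_seq_def)
      then show "N (restrict_seq {L * n * (j + 1)<..} x) \<le> N (restrict_seq {n * m<..} x)"
        using N_restrict[OF restrict_in[OF xX]] by metis
    qed (use d in auto)
    also have "\<dots> \<le> N ((B ^^ (n * m)) x)"
      using d by (intro N_B_iter_ge growth_power xX) auto
    finally show ?thesis by (simp add: power_divide)
  qed
  \<comment> \<open>An arbitrary time lies at most \<open>n\<close> steps before a multiple of
    \<open>n\<close>, and these steps enlarge the norm by a factor of at most
    \<open>C ^ n\<close>.\<close>
  have low': "1 / 2 \<le> C ^ n * N ((B ^^ j) x)" for j
  proof -
    define l where "l = n * (j div n + 1) - j"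
    have "j < n * (j div n + 1)" using d(2) dividend_less_times_div[of n j] by simp
    moreover have "n * (j div n) \<le> j" by (rule times_div_less_eq_dividend)
    ultimately have l: "l + j = n * (j div n + 1)" "l \<le> n"
      unfolding l_def distrib_left by linarith+
    have "1 / 2 \<le> N ((B ^^ (l + j)) x)" using low l(1) by metis
    also have "\<dots> \<le> C ^ l * N ((B ^^ j) x)"
      using N_B_iter_le[OF C(2,1) B_iter_in[OF xX]] by (simp add: funpow_add)
    also have "\<dots> \<le> C ^ n * N ((B ^^ j) x)"
      using C(1) l(2) N_nonneg[OF B_iter_in[OF xX]] by (intro mult_right_mono power_increasing) auto
    finally show ?thesis .
  qed
  obtain j where "N ((B ^^ j) x - 0) < 1 / (2 * C ^ n)"
    using hyp zero_in C(1) unfolding hypercyclic_vector_iff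
    by (metis divide_pos_pos less_le_trans zero_less_mult_iff zero_less_numeral zero_less_one zero_less_power)
  moreover have "0 < C ^ n" using C(1) by simp
  ultimately have "C ^ n * N ((B ^^ j) x) < 1 / 2" by (simp add: field_simps)
  with low'[of j] show False by simp
qed

section \<open>Consequences of hypercyclicity and of bounded infima\<close>

lemma growth_large:
  assumes "hypercyclic (norm_topology X N) B"
  obtains n where "n\<^sub>0 < n" "\<And>i. i \<in> {1..I} \<Longrightarrow> R \<le> growth n i"
proof -
  obtain x where x: "x \<in> X" "\<And>z e. z \<in> X \<Longrightarrow> 0 < e \<Longrightarrow> \<exists>n\<ge>1. N ((B ^^ n) x - z) < e"
    using assms unfolding hypercyclic_def hypercyclic_vector_iff by blast
  obtain C where C: "1 \<le> C" "\<And>n k. 1 \<le> k \<Longrightarrow> growth n k \<le> C ^ n"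
    using growth_bound by metis
  \<comment> \<open>No growth factor at a time up to \<open>n\<^sub>0\<close> reaches
    \<open>C ^ n\<^sub>0 + 1\<close>, so this part of the maximum forces
    \<open>n\<^sub>0 < n\<close>.\<close>
  define R' where "R' = max (max R 0) (C ^ n\<^sub>0 + 1)"
  define K where "K = 1 + R' * (N x + 1)"
  have K0: "0 \<le> K" using C(1) N_nonneg[OF x(1)] by (simp add: K_def R'_def le_max_iff_disj add_nonneg_nonneg mult_nonneg_nonneg)
  \<comment> \<open>The normalised coordinates of \<open>z\<close> up to \<open>Suc I\<close> are
    \<open>K\<close>, while an iterate of \<open>x\<close> has at most
    \<open>growth n i * N x\<close> there, so approximating \<open>z\<close> forces large growth.
    Going to \<open>Suc I\<close> keeps coordinate 1 available when \<open>I = 0\<close>.\<close>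
  define z :: "nat \<Rightarrow> 'a" where "z = restrict_seq {0<..Suc I} (\<lambda>k. of_real (K / u k))"
  have z: "z \<in> X" unfolding z_def by (intro finite_restrict) auto
  then obtain n where n: "N ((B ^^ n) x - z) < 1" using x(2)[of z 1] by auto
  have R': "R' \<le> growth n i" if i: "i \<in> {1..Suc I}" for i
  proof -
    have i1: "1 \<le> i" using i by simp
    have "K = norm (z i) * u i"
      using i u_pos[OF i1] K0 by (simp add: z_def restrict_seq_def norm_divide)
    also have "\<dots> \<le> (norm ((B ^^ n) x i) + norm (((B ^^ n) x - z) i)) * u i"
      using u_pos[OF i1] norm_triangle_sub[of "z i" "(B ^^ n) x i"] by (intro mult_right_mono) (auto simp: norm_minus_commute)
    also have "\<dots> = growth n i * (norm (x (i + n)) * u (i + n)) + norm (((B ^^ n) x - z) i) * u i"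
      using norm_B_iter[OF x(1) i1, of n] by (simp add: distrib_right)
    also have "\<dots> \<le> growth n i * N x + 1"
      using coord_le[OF x(1), of "i + n"] growth_pos[OF i1, of n] i1 n
        coord_le[OF diff_in[OF B_iter_in[OF x(1)] z] i1, of n]
      by (intro add_mono mult_left_mono) auto
    also have "\<dots> \<le> growth n i * (N x + 1) + 1"
      using growth_pos[OF i1, of n] by simp
    finally show ?thesis using N_nonneg[OF x(1)] by (simp add: K_def)
  qed
  show ?thesis
  proof
    show "n\<^sub>0 < n"
    proof (rule ccontr)
      assume "\<not> n\<^sub>0 < n"
      then have "C ^ n \<le> C ^ n\<^sub>0" using C(1) by (intro power_increasing) auto
      then show False using R'[of 1] C(2)[of 1 n] by (simp add: R'_def)
    qed
    show "R \<le> growth n i" if "i \<in> {1..I}" for i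
      using R'[of i] that by (simp add: R'_def)
  qed
qed

text \<open>
  Otherwise every late window could be cut from the right into blocks of length at most \<open>L\<close> and
  growth more than 2, so that the growth over long windows would tend to infinity uniformly.  The
  leftmost remainder causes no harm: a weight inside a block of growth at least 2 and length at most
  \<open>L\<close> is at least \<open>1 / C ^ L\<close>.
\<close>

lemma exists_bounded_suffixes:
  assumes H: "\<And>n. 1 \<le> n \<Longrightarrow> \<exists>k\<ge>1. growth n k \<le> K"
  obtains q where "q\<^sub>0 < q" "L < q" "\<And>l. l \<le> L \<Longrightarrow> growth l (q - l) \<le> 2"
proof (rule ccontr)
  note found = that
  assume "\<not> thesis"
  then have "\<exists>l\<le>L. 2 < growth l (q - l)" if q: "q\<^sub>0 < q" "L < q" for q
    using q found by (meson not_le)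
  then have ex: "\<exists>l. 1 \<le> l \<and> l \<le> L \<and> 2 < growth l (q - l)" if "q\<^sub>0 < q" "L < q" for q
    using that growth_0[of q] by (metis One_nat_def Suc_leI diff_zero gr0I le_less_trans not_le one_le_numeral zero_le)
  obtain C where C: "1 \<le> C" "\<And>n k. 1 \<le> k \<Longrightarrow> growth n k \<le> C ^ n"
    using growth_bound by metis
  define D where "D = q\<^sub>0 + L + 1"
  \<comment> \<open>A lower bound for all one-step factors: a finite minimum up to \<open>D\<close>,
    and beyond \<open>D\<close> the bound \<open>1 / C ^ L\<close> from the block ending at
    \<open>k + 1\<close>.\<close>
  define c where "c = Min (insert (1 / C ^ L) (growth 1 ` {1..D}))"
  have CL: "1 \<le> C ^ L" using C(1) by simp
  have c: "0 < c" "c \<le> 1"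
    using C(1) growth_pos CL by (auto simp: c_def Min_gr_iff Min_le_iff divide_le_eq)
  have c_le: "c \<le> growth 1 k" if k: "1 \<le> k" for k
  proof (cases "k \<le> D")
    case True
    then show ?thesis using k unfolding c_def by (intro Min_le) auto
  next
    case False
    then obtain l where l: "1 \<le> l" "l \<le> L" "2 < growth l (k + 1 - l)"
      using ex[of "k + 1"] by (auto simp: D_def)
    have kl: "1 \<le> k + 1 - l" using False l by (simp add: D_def)
    have "growth l (k + 1 - l) = growth (l - 1) (k + 1 - l) * growth 1 k"
      using growth_add[OF kl, of "l - 1" 1] l(1) kl by (simp add: le_imp_diff_is_add)
    also have "\<dots> \<le> C ^ L * growth 1 k"
    proof (intro mult_right_mono)
      have "C ^ (l - 1) \<le> C ^ L" using C(1) l by (intro power_increasing) auto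
      then show "growth (l - 1) (k + 1 - l) \<le> C ^ L" using C(2)[OF kl, of "l - 1"] by linarith
    qed (use growth_pos[OF k, of 1] in simp)
    finally have "1 / C ^ L \<le> growth 1 k" using l CL by (simp add: field_simps)
    moreover have "c \<le> 1 / C ^ L" by (auto simp: c_def)
    ultimately show ?thesis by linarith
  qed
  have c_pow: "c ^ n \<le> growth n k" if k: "1 \<le> k" for n k
    using growth_power[of c 1 k n] c_le c k by simp
  have "0 < L" using ex[of "q\<^sub>0 + L + 1"] by (cases L) auto
  \<comment> \<open>A block of length \<open>l \<le> L\<close> has growth above 2, hence at least
    \<open>\<theta> ^ l\<close>: exponential growth at a rate independent of the block
    lengths.\<close>
  define \<theta> where "\<theta> = root L 2"
  have \<theta>: "1 < \<theta>" "\<theta> ^ L = 2" using \<open>0 < L\<close> by (auto simp: \<theta>_def real_root_pow_pos2)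
  \<comment> \<open>Strong induction strips the last block while \<open>n > D\<close>; the leftover
    of length at most \<open>D\<close> has only the factor \<open>c\<close> per step, and
    \<open>(c / \<theta>) ^ D\<close> absorbs it.\<close>
  have lower: "(c / \<theta>) ^ D * \<theta> ^ n \<le> growth n k" if "1 \<le> k" for n k
    using that
  proof (induction n rule: less_induct)
    case (less n)
    show ?case
    proof (cases "n \<le> D")
      case True
      have "(c / \<theta>) ^ D * \<theta> ^ n \<le> (c / \<theta>) ^ n * \<theta> ^ n"
        using True c \<theta>(1) by (intro mult_right_mono power_decreasing) auto
      also have "\<dots> = c ^ n" using \<theta>(1) by (simp add: power_divide)
      finally show ?thesis using c_pow[OF less.prems] order_trans by blast
    next
      case False
      then obtain l where l: "1 \<le> l" "l \<le> L" "2 < growth l (k + n - l)"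
        using ex[of "k + n"] by (auto simp: D_def)
      have ln: "l < n" using l False by (simp add: D_def)
      have "\<theta> ^ l \<le> 2" using power_increasing[of l L \<theta>] \<theta> l by simp
      then have "((c / \<theta>) ^ D * \<theta> ^ (n - l)) * \<theta> ^ l \<le> growth (n - l) k * growth l (k + n - l)"
        using less.IH[of "n - l"] less.prems l ln growth_pos[OF less.prems, of "n - l"] c \<theta>(1)
        by (intro mult_mono) auto
      also have "\<dots> = growth n k"
        using growth_add[OF less.prems, of "n - l" l] ln by simp
      finally show ?thesis using ln by (simp add: mult.assoc flip: power_add)
    qed
  qed
  have pos: "0 < (c / \<theta>) ^ D" using c \<theta> by simp
  obtain n where n: "K / (c / \<theta>) ^ D < \<theta> ^ n" using real_arch_pow[OF \<theta>(1)] by blast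
  obtain k where k: "1 \<le> k" "growth (Suc n) k \<le> K" using H[of "Suc n"] by auto
  have "K < (c / \<theta>) ^ D * \<theta> ^ n" using n pos by (simp add: pos_divide_less_eq mult.commute)
  also have "\<dots> \<le> (c / \<theta>) ^ D * \<theta> ^ Suc n"
    using pos \<theta>(1) by (intro mult_left_mono power_increasing) auto
  also have "\<dots> \<le> K" using lower[OF k(1), of "Suc n"] k(2) by linarith
  finally show False by simp
qed

end

section \<open>Construction of a hypercyclic subspace\<close>

lemma dense_sequence:
  obtains d :: "nat \<Rightarrow> 'a::{real_normed_vector,second_countable_topology}"
  where "\<And>a e. 0 < e \<Longrightarrow> \<exists>i. norm (d i - a) < e"
proof -
  obtain D :: "'a set" where D: "countable D" "\<And>U. open U \<Longrightarrow> U \<noteq> {} \<Longrightarrow> \<exists>d\<in>D. d \<in> U"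
    using countable_dense_exists by blast
  have "D \<noteq> {}" using D(2)[of UNIV] by auto
  show ?thesis
  proof (rule that[of "from_nat_into D"])
    fix a :: 'a and e :: real assume "0 < e"
    then have "ball a e \<noteq> {}" by simp
    then obtain b where b: "b \<in> D" "b \<in> ball a e" using D(2)[OF open_ball] by blast
    obtain i where "from_nat_into D i = b" using from_nat_into_surj[OF D(1) b(1)] by blast
    then show "\<exists>i. norm (from_nat_into D i - a) < e"
      using b(2) by (intro exI[of _ i]) (simp add: dist_norm norm_minus_commute)
  qed
qed

context weighted_seq_space
begin

lemma dense_finite_sequences:
  obtains y :: "nat \<Rightarrow> nat \<Rightarrow> 'a" and I :: "nat \<Rightarrow> nat"
  where "\<And>i k. k \<notin> {1..I i} \<Longrightarrow> y i k = 0"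
    and "\<And>z e. z \<in> X \<Longrightarrow> 0 < e \<Longrightarrow> \<exists>i. N (y i - z) < e"
proof -
  obtain d :: "nat \<Rightarrow> 'a" where d: "\<And>a e. 0 < e \<Longrightarrow> \<exists>i. norm (d i - a) < e"
    using dense_sequence by blast
  \<comment> \<open>A list of naturals encodes a finite sequence with values taken from the dense
    sequence \<open>d\<close>; list positions start at 0 and coordinates at 1, whence
    \<open>k - 1\<close>.\<close>
  define y where "y i k = (let l = from_nat i :: nat list in if k \<in> {1..length l} then d (l ! (k - 1)) else 0)" for i k
  show ?thesis
  proof
    show "y i k = 0" if "k \<notin> {1..length (from_nat i :: nat list)}" for i k
      unfolding y_def Let_def using that by (rule if_not_P)
    fix z and e :: real assume z: "z \<in> X" and e: "0 < e"
    obtain r where r: "N (restrict_seq {r<..} z) < e / 2"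
      using eventually_happens'[OF sequentially_bot order_tendstoD(2)[OF tail[OF z], of "e/2"]] e by auto
    \<comment> \<open>These tolerances make the weighted errors on \<open>{1..r}\<close> sum to at
      most \<open>e / 2\<close>; the tail of \<open>z\<close> takes the other half.\<close>
    have "\<forall>k\<in>{1..r}. \<exists>i. norm (d i - z k) < e / (2 * (r + 1) * u k)"
      using d e u_pos by auto
    then obtain f where f: "\<And>k. k \<in> {1..r} \<Longrightarrow> norm (d (f k) - z k) < e / (2 * (r + 1) * u k)"
      by metis
    define i where "i = to_nat (map f [1..<r + 1])"
    have y: "y i k = (if k \<in> {1..r} then d (f k) else 0)" for k
      by (cases k) (simp_all add: y_def i_def del: upt_Suc)
    have "y i - z = restrict_seq {1..r} (y i - z) - restrict_seq {r<..} z"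
      using at_0[OF z] by (auto simp: restrict_seq_def y fun_eq_iff not_le less_Suc_eq)
    moreover have "restrict_seq {1..r} (y i - z) \<in> X"
      by (intro finite_restrict) auto
    ultimately have "N (y i - z) \<le> N (restrict_seq {1..r} (y i - z)) + N (restrict_seq {r<..} z)"
      using N_diff restrict_in[OF z] by metis
    moreover have "N (restrict_seq {1..r} (y i - z)) \<le> (\<Sum>k\<in>{1..r}. norm ((y i - z) k) * u k)"
      by (intro finite_restrict) auto
    moreover have "\<dots> \<le> (\<Sum>k\<in>{1..r}. e / (2 * (r + 1)))"
    proof (rule sum_mono)
      fix k assume k: "k \<in> {1..r}"
      then have "norm ((y i - z) k) * u k \<le> e / (2 * (r + 1) * u k) * u k"
        using f[OF k] u_pos[of k] by (intro mult_right_mono) (auto simp: y)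
      then show "norm ((y i - z) k) * u k \<le> e / (2 * (r + 1))"
        using u_pos[of k] k by simp
    qed
    moreover have "\<dots> \<le> e / 2" using e by (simp add: field_simps)
    ultimately show "\<exists>i. N (y i - z) < e" using r by (intro exI[of _ i]) linarith
  qed
qed

text \<open>The index \<open>t\<close> encodes a triple: the pivot it serves, the target, and a
  dummy third entry that makes every pair of the first two recur arbitrarily late.\<close>

lemma target_schedule:
  obtains y :: "nat \<Rightarrow> nat \<Rightarrow> 'a" and I m :: "nat \<Rightarrow> nat"
  where "\<And>t k. k \<notin> {1..I t} \<Longrightarrow> y t k = 0"
    and "\<And>z e \<mu> T. z \<in> X \<Longrightarrow> 0 < e \<Longrightarrow> \<exists>t\<ge>T. m t = \<mu> \<and> N (y t - z) < e"
proof -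
  obtain y :: "nat \<Rightarrow> nat \<Rightarrow> 'a" and I :: "nat \<Rightarrow> nat"
    where y: "\<And>i k. k \<notin> {1..I i} \<Longrightarrow> y i k = 0"
      "\<And>z e. z \<in> X \<Longrightarrow> 0 < e \<Longrightarrow> \<exists>i. N (y i - z) < e"
    using dense_finite_sequences by metis
  define m i where "m t = fst (from_nat t :: nat \<times> nat \<times> nat)"
    and "i t = fst (snd (from_nat t :: nat \<times> nat \<times> nat))" for t
  show ?thesis
  proof (rule that[of "I \<circ> i" "y \<circ> i" m])
    show "(y \<circ> i) t k = 0" if "k \<notin> {1..(I \<circ> i) t}" for t k
      using y(1) that by simp
    fix z and e :: real and \<mu> T :: nat assume "z \<in> X" "0 < e"
    then obtain j where j: "N (y j - z) < e" using y(2) by blast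
    have "inj (\<lambda>r. to_nat (\<mu>, j, r::nat))" by (auto simp: inj_def)
    then have "infinite (range (\<lambda>r. to_nat (\<mu>, j, r::nat)))" by (rule range_inj_infinite)
    then obtain r where "T \<le> to_nat (\<mu>, j, r::nat)"
      unfolding infinite_nat_iff_unbounded_le by blast
    then show "\<exists>t\<ge>T. m t = \<mu> \<and> N ((y \<circ> i) t - z) < e"
      using j by (intro exI[of _ "to_nat (\<mu>, j, r)"]) (simp add: m_def i_def)
  qed
qed

end

section \<open>Alternating choice of times and pivots\<close>

context weighted_shift_space
begin

text \<open>Dependent choice on pairs: \<open>growth_large\<close> picks a time beyond the last
  pivot, with growth enlarged by \<open>C ^ n\<close> for the preceding time \<open>n\<close>;
  \<open>exists_bounded_suffixes\<close> then picks a pivot beyond the new block.\<close>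

lemma interlacing:
  fixes I :: "nat \<Rightarrow> nat" and R :: "nat \<Rightarrow> real"
  assumes hyp: "hypercyclic (norm_topology X N) B"
    and H: "\<And>n. 1 \<le> n \<Longrightarrow> \<exists>k\<ge>1. growth n k \<le> b"
  obtains n q :: "nat \<Rightarrow> nat" and K :: "nat \<Rightarrow> real"
  where "\<And>s. n s + I s < q s" "\<And>s. q s < n (Suc s)"
    and "\<And>s l. l \<le> n s \<Longrightarrow> growth l (q s - l) \<le> 2"
    and "\<And>s. 1 \<le> K s" "\<And>s t k. t < s \<Longrightarrow> 1 \<le> k \<Longrightarrow> growth (n t) k \<le> K s"
    and "\<And>s i. i \<in> {1..I s} \<Longrightarrow> K s * R s \<le> growth (n s) i"
proof -
  obtain C where C: "1 \<le> C" "\<And>n k. 1 \<le> k \<Longrightarrow> growth n k \<le> C ^ n"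
    using growth_bound by metis
  \<comment> \<open>\<open>?Q\<close> constrains the growth only at successors, so the clause for
    \<open>s = 0\<close> supplies the first growth condition, matching
    \<open>K 0 = 1\<close>.\<close>
  let ?P = "\<lambda>s (n, q). n + I s < q \<and> (\<forall>l\<le>n. growth l (q - l) \<le> 2) \<and> (s = 0 \<longrightarrow> (\<forall>i\<in>{1..I s}. R s \<le> growth n i))"
  let ?Q = "\<lambda>s (n, q) (n', q'). q < n' \<and> (\<forall>i\<in>{1..I (Suc s)}. C ^ n * R (Suc s) \<le> growth n' i)"
  have q: "\<exists>q. n + I s < q \<and> (\<forall>l\<le>n. growth l (q - l) \<le> 2)" for n s
    using exists_bounded_suffixes[OF H, of "n + I s" n] by metis
  have "\<exists>p. \<forall>s. ?P s (p s) \<and> ?Q s (p s) (p (Suc s))"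
  proof (rule dependent_nat_choice[of ?P ?Q])
    obtain n where "\<And>i. i \<in> {1..I 0} \<Longrightarrow> R 0 \<le> growth n i"
      using growth_large[OF hyp, of 0 "I 0" "R 0"] by metis
    moreover obtain q' where "n + I 0 < q'" "\<forall>l\<le>n. growth l (q' - l) \<le> 2" using q by blast
    ultimately show "\<exists>p. ?P 0 p" by (intro exI[of _ "(n, q')"]) auto
    fix p :: "nat \<times> nat" and s :: nat
    obtain n q' where p: "p = (n, q')" by (rule prod.exhaust)
    obtain n' where n': "q' < n'" "\<And>i. i \<in> {1..I (Suc s)} \<Longrightarrow> C ^ n * R (Suc s) \<le> growth n' i"
      using growth_large[OF hyp, of q' "I (Suc s)" "C ^ n * R (Suc s)"] by metis
    obtain q'' where "n' + I (Suc s) < q''" "\<forall>l\<le>n'. growth l (q'' - l) \<le> 2" using q by blast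
    then show "\<exists>p'. ?P (Suc s) p' \<and> ?Q s p p'"
      using n' by (intro exI[of _ "(n', q'')"]) (auto simp: p)
  qed
  then obtain p where p: "\<forall>s. ?P s (p s) \<and> ?Q s (p s) (p (Suc s))" by (rule exE)
  define n where "n s = fst (p s)" for s
  define q where "q s = snd (p s)" for s
  define K where "K s = (case s of 0 \<Rightarrow> 1 | Suc r \<Rightarrow> C ^ n r)" for s
  have P: "n s + I s < q s" "l \<le> n s \<Longrightarrow> growth l (q s - l) \<le> 2" "i \<in> {1..I 0} \<Longrightarrow> R 0 \<le> growth (n 0) i"
    "q s < n (Suc s)" "i \<in> {1..I (Suc s)} \<Longrightarrow> C ^ n s * R (Suc s) \<le> growth (n (Suc s)) i" for s l i
    using p[rule_format, of s] p[rule_format, of 0] by (auto simp: n_def q_def split: prod.splits)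
  have "n s < n (Suc s)" for s using P(1,4)[of s] by linarith
  then have mono: "mono n" by (intro mono_iff_le_Suc[THEN iffD2]) (simp add: less_imp_le)
  show ?thesis
  proof (rule that[of n q K])
    show "n s + I s < q s" "q s < n (Suc s)" for s by (rule P)+
    show "growth l (q s - l) \<le> 2" if "l \<le> n s" for s l using that by (rule P)
    show "1 \<le> K s" for s using C(1) by (simp add: K_def split: nat.split)
    show "growth (n t) k \<le> K s" if ts: "t < s" and k: "1 \<le> k" for s t k
    proof -
      obtain r where r: "s = Suc r" "t \<le> r" using ts by (cases s) auto
      have "growth (n t) k \<le> C ^ n t" using C(2)[OF k] .
      also have "\<dots> \<le> C ^ n r" using C(1) monoD[OF mono r(2)] by (intro power_increasing) auto
      finally show ?thesis by (simp add: K_def r)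
    qed
    show "K s * R s \<le> growth (n s) i" if "i \<in> {1..I s}" for s i

    proof (cases s)
      case 0
      then show ?thesis using P(3) that by (simp add: K_def)
    next
      case (Suc r)
      then show ?thesis using P(5)[of i r] that by (simp add: K_def)
    qed
  qed
qed

end

text \<open>
  Block \<open>s\<close>, the interval from \<open>n s + 1\<close> to \<open>n s + I s\<close>, carries a preimage of the target \<open>y s\<close> under
  \<open>B ^^ n s\<close>, scaled by the coefficient of the vector at the pivot \<open>q (m s)\<close>.  At time \<open>n t\<close> every
  earlier block and pivot has been shifted out, later pivots have grown by at most the factor 2, and
  later blocks are negligible since \<open>K s\<close> compensates the growth up to all earlier times.
\<close>

locale interlaced_blocks = weighted_shift_space X N u w B
  for X :: "(nat \<Rightarrow> 'a::{real_normed_field,banach,second_countable_topology}) set"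
    and N :: "(nat \<Rightarrow> 'a) \<Rightarrow> real" and u :: "nat \<Rightarrow> real" and w B +
  fixes n q I m :: "nat \<Rightarrow> nat" and K :: "nat \<Rightarrow> real" and y :: "nat \<Rightarrow> nat \<Rightarrow> 'a"
  assumes below_pivot: "n s + I s < q s" and above_pivot: "q s < n (Suc s)"
    and suffix: "l \<le> n s \<Longrightarrow> growth l (q s - l) \<le> 2"
    and K_ge_1: "1 \<le> K s" and K_ge: "t < s \<Longrightarrow> 1 \<le> k \<Longrightarrow> growth (n t) k \<le> K s"
    and growth_ge: "i \<in> {1..I s} \<Longrightarrow> K s * (2 ^ s * ((\<Sum>j\<in>{1..I s}. norm (y s j) * u j) + 1)) \<le> growth (n s) i"
    and target_support: "k \<notin> {1..I t} \<Longrightarrow> y t k = 0"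
    and targets_dense: "z \<in> X \<Longrightarrow> 0 < e \<Longrightarrow> \<exists>t\<ge>T. m t = \<mu> \<and> N (y t - z) < e"
begin

section \<open>Blocks, pivots and the block space\<close>

definition block :: "nat \<Rightarrow> nat set" where
  "block s = {n s<..n s + I s}"

definition preimage :: "nat \<Rightarrow> nat \<Rightarrow> 'a" where
  "preimage s k = (if k \<in> block s then y s (k - n s) / (\<Prod>\<nu>=1..n s. w (\<nu> + (k - n s))) else 0)"

text \<open>The coefficient relative to the normalised unit sequence at the pivot; with this scaling
  \<open>coord_le\<close> bounds it by \<open>N x\<close>.\<close>

definition coeff :: "nat \<Rightarrow> (nat \<Rightarrow> 'a) \<Rightarrow> 'a" where
  "coeff \<mu> x = x (q \<mu>) * of_real (u (q \<mu>))"

text \<open>Linear equations between coordinates replace the closed span of generators: closedness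
  becomes a matter of coordinatewise limits, and every member displays its coefficients at the
  pivots.\<close>

definition block_space :: "(nat \<Rightarrow> 'a) set" where
  "block_space = {x \<in> X. (\<forall>s. \<forall>k\<in>block s. x k = coeff (m s) x * preimage s k) \<and>
     (\<forall>k. k \<notin> (\<Union>s. block s) \<and> k \<notin> range q \<longrightarrow> x k = 0)}"

lemma block_space_in: "x \<in> block_space \<Longrightarrow> x \<in> X"
  and block_space_block: "x \<in> block_space \<Longrightarrow> k \<in> block s \<Longrightarrow> x k = coeff (m s) x * preimage s k"
  and block_space_zero: "x \<in> block_space \<Longrightarrow> k \<notin> (\<Union>s. block s) \<Longrightarrow> k \<notin> range q \<Longrightarrow> x k = 0"
  unfolding block_space_def by blast+

lemma block_spaceI:
  assumes "x \<in> X" "\<And>s k. k \<in> block s \<Longrightarrow> x k = coeff (m s) x * preimage s k"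
    and "\<And>k. k \<notin> (\<Union>s. block s) \<and> k \<notin> range q \<Longrightarrow> x k = 0"
  shows "x \<in> block_space"
  using assms unfolding block_space_def mem_Collect_eq by (intro conjI allI ballI impI)

lemma n_mono: "s \<le> t \<Longrightarrow> n s \<le> n t"
proof (erule lift_Suc_mono_le[rotated])
  show "n s \<le> n (Suc s)" for s using below_pivot[of s] above_pivot[of s] by linarith
qed

lemma pivot_less: "s < t \<Longrightarrow> q s < n t"
  using above_pivot[of s] n_mono[of "Suc s" t] by simp

lemma pivot_pos: "1 \<le> q s"
  using below_pivot[of s] by simp

lemma block_unique: "k \<in> block s \<Longrightarrow> k \<in> block t \<Longrightarrow> s = t"
  using pivot_less[of s t] pivot_less[of t s] below_pivot[of s] below_pivot[of t]
  by (cases s t rule: linorder_cases) (auto simp: block_def)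

lemma pivot_notin_block: "q s \<notin> block t"
  using pivot_less[of s t] n_mono[of t s] pivot_less[of t s] below_pivot[of s] below_pivot[of t]
  by (cases s t rule: linorder_cases) (auto simp: block_def)

lemma pivot_inj: "q s = q t \<longleftrightarrow> s = t"
  using pivot_less[of s t] pivot_less[of t s] below_pivot[of s] below_pivot[of t]
  by (cases s t rule: linorder_cases) auto

lemma n_ge: "t \<le> n t"
proof (induction t)
  case (Suc t)
  then show ?case using below_pivot[of t] above_pivot[of t] by linarith
qed simp

lemma target_in: "y t \<in> X"
proof -
  have "y t = restrict_seq {1..I t} (y t)"
    using target_support by (auto simp: restrict_seq_def fun_eq_iff)
  then show ?thesis using finite_restrict(1)[of "{1..I t}" "y t"] by auto
qed

lemma norm_preimage:
  assumes "i \<in> {1..I s}"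
  shows "norm (preimage s (i + n s)) * u (i + n s) = norm (y s i) * u i / growth (n s) i"
  using assms u_pos[of i] u_pos[of "i + n s"]
  by (simp add: preimage_def block_def growth_def norm_divide prod_norm field_simps)

text \<open>The bound \<open>growth_ge\<close> is tailored to this: with \<open>S\<close> the sum of
  the normalised coordinates of the target, multiplication by \<open>K s\<close> leaves
  \<open>S / (S + 1)\<close> times \<open>(1/2) ^ s\<close>. The added 1 keeps the divisor positive
  for a zero target.\<close>

lemma preimage_in: "preimage s \<in> X"
  and N_preimage: "K s * N (preimage s) \<le> (1/2) ^ s"
proof -
  define S where "S = (\<Sum>j\<in>{1..I s}. norm (y s j) * u j)"
  have S0: "0 \<le> S" using u_pos by (auto simp: S_def less_imp_le intro!: sum_nonneg)
  have F: "finite (block s)" "block s \<subseteq> {1..}" by (auto simp: block_def)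
  have eq: "preimage s = restrict_seq (block s) (preimage s)"
    by (auto simp: restrict_seq_def preimage_def)
  then show "preimage s \<in> X" using finite_restrict(1)[OF F] by metis
  have "N (preimage s) \<le> (\<Sum>k\<in>block s. norm (preimage s k) * u k)"
    using finite_restrict(2)[OF F] eq by metis
  also have "\<dots> = (\<Sum>i\<in>{1..I s}. norm (preimage s (i + n s)) * u (i + n s))"
    by (rule sum.reindex_bij_witness[of _ "\<lambda>i. i + n s" "\<lambda>k. k - n s"]) (auto simp: block_def)
  also have "\<dots> = (\<Sum>i\<in>{1..I s}. norm (y s i) * u i / growth (n s) i)"
    by (intro sum.cong refl norm_preimage)
  also have "\<dots> \<le> (\<Sum>i\<in>{1..I s}. norm (y s i) * u i / (K s * (2 ^ s * (S + 1))))"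
  proof (rule sum_mono)
    fix i assume i: "i \<in> {1..I s}"
    show "norm (y s i) * u i / growth (n s) i \<le> norm (y s i) * u i / (K s * (2 ^ s * (S + 1)))"
      using growth_ge[OF i] i u_pos[of i] growth_pos[of i] K_ge_1[of s] S0
      unfolding S_def[symmetric] by (intro divide_left_mono mult_pos_pos) (auto simp: less_imp_le)
  qed
  also have "\<dots> = S / (K s * (2 ^ s * (S + 1)))"
    by (simp add: S_def sum_divide_distrib)
  finally have "K s * N (preimage s) \<le> K s * (S / (K s * (2 ^ s * (S + 1))))"
    using K_ge_1[of s] by (intro mult_left_mono) auto
  also have "\<dots> = (1/2) ^ s * (S / (S + 1))"
    using K_ge_1[of s] by (simp add: power_divide)
  also have "\<dots> \<le> (1/2) ^ s * 1"
    using S0 by (intro mult_left_mono) (auto simp: divide_le_eq)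
  finally show "K s * N (preimage s) \<le> (1/2) ^ s" by simp
qed

text \<open>The blocks are disjoint, so this glues all \<open>preimage s\<close>, enlarged by
  \<open>K s\<close>, into one element of \<open>X\<close>. Up to the factor \<open>N x\<close> it
  dominates what later blocks contribute at any time \<open>n t\<close>.\<close>

definition majorant :: "nat \<Rightarrow> 'a" where
  "majorant k = (\<Sum>s. scale_seq (of_real (K s)) (preimage s) k)"

lemma majorant_in: "majorant \<in> X"
  unfolding majorant_def[abs_def]
proof (rule series(1)[where c = "\<lambda>s. (1/2) ^ s"])
  show "N (scale_seq (of_real (K s)) (preimage s)) \<le> (1/2) ^ s" for s
    using N_preimage[of s] K_ge_1[of s] by (simp add: N_scale preimage_in)
qed (auto intro: scale_in preimage_in)

lemma majorant_block: "k \<in> block s \<Longrightarrow> majorant k = of_real (K s) * preimage s k"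
proof -
  assume k: "k \<in> block s"
  have "(\<Sum>s. scale_seq (of_real (K s)) (preimage s) k) = (\<Sum>s\<in>{s}. scale_seq (of_real (K s)) (preimage s) k)"
    using block_unique[OF k] by (intro suminf_finite) (auto simp: scale_seq_def preimage_def)
  then show ?thesis by (simp add: majorant_def scale_seq_def)
qed

lemma majorant_pivot: "majorant (q s) = 0"
  using pivot_notin_block[of s] by (simp add: majorant_def scale_seq_def preimage_def)

section \<open>Closedness and infinite dimension of the block space\<close>

lemma subspace_block_space: "seq.subspace block_space"
proof (rule seq.subspaceI)
  show "0 \<in> block_space" by (simp add: block_space_def coeff_def zero_in)
  show "x + y \<in> block_space" if "x \<in> block_space" "y \<in> block_space" for x y
    using that add_in[of x y] by (simp add: block_space_def coeff_def distrib_right)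
  show "scale_seq c x \<in> block_space" if "x \<in> block_space" for c x
    using that scale_in[of x c] by (simp add: block_space_def coeff_def) (simp add: scale_seq_def)
qed

lemma closedin_block_space: "closedin mtopology block_space"
  unfolding metric_closedin_iff_sequentially_closed
proof (intro conjI allI impI)
  show "block_space \<subseteq> X" using block_space_in by blast
  fix \<sigma> l assume A: "range \<sigma> \<subseteq> block_space \<and> limitin mtopology \<sigma> l sequentially"
  then have \<sigma>: "\<sigma> i \<in> block_space" "\<sigma> i \<in> X" for i using block_space_in by blast+
  have l: "l \<in> X" using limitin_topspace[OF conjunct2[OF A]] by simp
  have N_lim: "(\<lambda>i. N (\<sigma> i - l)) \<longlonglongrightarrow> 0"
  proof (rule LIMSEQ_I)
    fix e :: real assume "0 < e"
    then obtain j where j: "\<And>i. j \<le> i \<Longrightarrow> norm_dist X N (\<sigma> i) l < e"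
      using conjunct2[OF A] unfolding limit_metric_sequentially by blast
    have "norm (N (\<sigma> i - l) - 0) < e" if "j \<le> i" for i
      using j[OF that] N_nonneg[OF diff_in[OF \<sigma>(2) l], of i] by (simp add: norm_dist_eq \<sigma>(2) l)
    then show "\<exists>j. \<forall>i\<ge>j. norm (N (\<sigma> i - l) - 0) < e" by blast
  qed
  have lim: "(\<lambda>i. \<sigma> i k) \<longlonglongrightarrow> l k" for k
  proof (cases "1 \<le> k")
    case True
    have "norm (\<sigma> i k - l k) \<le> N (\<sigma> i - l) / u k" for i
    proof -
      have diff: "(\<sigma> i - l) k = \<sigma> i k - l k" by simp
      have "norm ((\<sigma> i - l) k) * u k \<le> N (\<sigma> i - l)"
        using diff_in[OF \<sigma>(2) l] True by (rule coord_le)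
      from mult_imp_le_div_pos[OF u_pos[OF True] this[unfolded diff]] show ?thesis .
    qed
    moreover have "(\<lambda>i. N (\<sigma> i - l) / u k) \<longlonglongrightarrow> 0" using N_lim by (rule tendsto_divide_zero)
    ultimately have "(\<lambda>i. \<sigma> i k - l k) \<longlonglongrightarrow> 0"
      by (rule Lim_null_comparison[OF eventuallyI])
    then show ?thesis by (rule LIM_zero_cancel)
  next
    case False
    then have "k = 0" by simp
    then show ?thesis by (simp add: at_0[OF \<sigma>(2)] at_0[OF l])
  qed
  have "l k = coeff (m s) l * preimage s k" if "k \<in> block s" for s k
  proof (rule LIMSEQ_unique[OF lim])
    have eq: "(\<lambda>i. \<sigma> i k) = (\<lambda>i. coeff (m s) (\<sigma> i) * preimage s k)"
      using block_space_block[OF \<sigma>(1) that] by (rule ext)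
    have "(\<lambda>i. coeff (m s) (\<sigma> i)) \<longlonglongrightarrow> coeff (m s) l"
      unfolding coeff_def by (rule tendsto_mult[OF lim tendsto_const])
    then show "(\<lambda>i. \<sigma> i k) \<longlonglongrightarrow> coeff (m s) l * preimage s k"
      unfolding eq by (rule tendsto_mult[OF _ tendsto_const])
  qed
  moreover have "l k = 0" if "k \<notin> (\<Union>s. block s) \<and> k \<notin> range q" for k
  proof (rule LIMSEQ_unique[OF lim])
    have "\<sigma> i k = 0" for i
      using block_space_zero[OF \<sigma>(1)] that by blast
    then show "(\<lambda>i. \<sigma> i k) \<longlonglongrightarrow> 0" by simp
  qed
  ultimately show "l \<in> block_space" by (intro block_spaceI[OF l])
qed

text \<open>The perturbed unit sequences of the overview, normalised so that
  \<open>coeff \<mu>\<close> takes the value 1 on \<open>generator \<mu>\<close>. As blocks are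
  disjoint, \<open>THE\<close> selects the block containing \<open>k\<close>.\<close>

definition generator :: "nat \<Rightarrow> nat \<Rightarrow> 'a" where
  "generator \<mu> k = (if k = q \<mu> then of_real (1 / u k)
     else if \<exists>s. m s = \<mu> \<and> k \<in> block s then preimage (THE s. k \<in> block s) k else 0)"

lemma generator_block:
  assumes "k \<in> block s"
  shows "generator \<mu> k = (if m s = \<mu> then preimage s k else 0)"
proof -
  have "(THE s. k \<in> block s) = s" using assms block_unique by blast
  moreover have "k \<noteq> q \<mu>" using assms pivot_notin_block by auto
  moreover have "(\<exists>s. m s = \<mu> \<and> k \<in> block s) \<longleftrightarrow> m s = \<mu>" using assms block_unique by blast
  ultimately show ?thesis by (simp add: generator_def)
qed

lemma generator_pivot: "generator \<mu> (q \<nu>) = (if \<mu> = \<nu> then of_real (1 / u (q \<nu>)) else 0)"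
  using pivot_notin_block by (auto simp: generator_def pivot_inj)

lemma generator_in: "generator \<mu> \<in> block_space"
proof -
  have "generator \<mu> \<in> X"
  proof (rule solid(1))
    \<comment> \<open>At the pivot the first summand matches \<open>generator \<mu>\<close>, and on
      the blocks the majorant dominates it because \<open>1 \<le> K s\<close>; solidity then gives
      membership without summing a series.\<close>
    let ?y = "scale_seq (of_real (1 / u (q \<mu>))) (unit_seq (q \<mu>)) + majorant"
    show "?y \<in> X" by (intro add_in scale_in unit_in majorant_in pivot_pos)
    show "generator \<mu> 0 = 0" using pivot_pos[of \<mu>] by (auto simp: generator_def block_def)
    fix k
    consider "k = q \<mu>" | s where "k \<in> block s" | "k \<noteq> q \<mu>" "\<And>s. k \<notin> block s" by blast
    then show "norm (generator \<mu> k) \<le> norm (?y k)"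
    proof cases
      case 1
      then show ?thesis using pivot_pos[of \<mu>]
        by (simp add: generator_pivot majorant_pivot scale_seq_def unit_seq_def)
    next
      case 2
      then have "k \<noteq> q \<mu>" using pivot_notin_block by auto
      moreover have "norm (preimage s k) \<le> K s * norm (preimage s k)"
        using mult_right_mono[OF K_ge_1[of s], of "norm (preimage s k)"] by simp
      ultimately show ?thesis using K_ge_1[of s] 2
        by (simp add: generator_block majorant_block scale_seq_def unit_seq_def norm_mult)
    next
      case 3
      then show ?thesis by (simp add: generator_def)
    qed
  qed
  then show ?thesis
  proof (rule block_spaceI)
    show "generator \<mu> k = coeff (m s) (generator \<mu>) * preimage s k" if "k \<in> block s" for s k
      using u_pos[OF pivot_pos, of "m s"]
      by (auto simp: generator_block[OF that] coeff_def generator_pivot simp flip: of_real_mult)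
    show "generator \<mu> k = 0" if "k \<notin> (\<Union>s. block s) \<and> k \<notin> range q" for k
      using that by (auto simp: generator_def)
  qed
qed

lemma not_finite_span_block_space: "\<not> (\<exists>S. finite S \<and> block_space = seq.span S)"
proof
  assume "\<exists>S. finite S \<and> block_space = seq.span S"
  then obtain S where S: "finite S" "block_space = seq.span S" by blast
  have inj: "inj generator"
  proof (rule injI)
    fix \<mu> \<nu> assume "generator \<mu> = generator \<nu>"
    then have "generator \<mu> (q \<nu>) = generator \<nu> (q \<nu>)" by simp
    then show "\<mu> = \<nu>" using u_pos[OF pivot_pos, of \<nu>] by (simp add: generator_pivot split: if_splits)
  qed
  have "seq.independent (range generator)"
  proof
    assume "seq.dependent (range generator)"
    then obtain \<mu> where \<mu>: "generator \<mu> \<in> seq.span (range generator - {generator \<mu>})"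
      unfolding seq.dependent_def by (elim bexE rangeE) simp
    \<comment> \<open>All generators other than \<open>generator \<mu>\<close> vanish at
      \<open>q \<mu>\<close>, hence so does their span, whereas \<open>generator \<mu>\<close> does
      not.\<close>
    have "seq.subspace {x :: nat \<Rightarrow> 'a. x (q \<mu>) = 0}"
      by (rule seq.subspaceI) (auto simp: scale_seq_def)
    moreover have "range generator - {generator \<mu>} \<subseteq> {x. x (q \<mu>) = 0}"
    proof
      fix x assume "x \<in> range generator - {generator \<mu>}"
      then obtain \<nu> where "x = generator \<nu>" "\<nu> \<noteq> \<mu>" by blast
      then show "x \<in> {x. x (q \<mu>) = 0}" by (simp add: generator_pivot)
    qed
    ultimately have "seq.span (range generator - {generator \<mu>}) \<subseteq> {x. x (q \<mu>) = 0}"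
      by (intro seq.span_minimal)
    then have "generator \<mu> (q \<mu>) = 0" using \<mu> by (auto simp only: subset_iff mem_Collect_eq)
    then show False using u_pos[OF pivot_pos, of \<mu>] by (simp add: generator_pivot)
  qed
  moreover have "range generator \<subseteq> seq.span S"
    unfolding S(2)[symmetric] by (rule image_subsetI) (rule generator_in)
  ultimately have "finite (range generator)"
    using seq.independent_span_bound[OF S(1), of "range generator"] by simp
  then show False using range_inj_infinite[OF inj] by blast
qed

text \<open>The bound is a tail of a single element of \<open>X\<close> that does not depend on
  \<open>t\<close>, so \<open>tail\<close> sends the remainder to 0 along the times
  \<open>n t\<close>. The summand \<open>2 * norm (x k)\<close> serves later pivots and the majorant
  later blocks.\<close>

lemma remainder_le:
  assumes x: "x \<in> block_space"
  shows "N ((B ^^ n t) x - scale_seq (coeff (m t) x) (y t))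
    \<le> N (restrict_seq {n t<..} (\<lambda>k. of_real (2 * norm (x k) + N x * norm (majorant k))))"
    and "(\<lambda>k. of_real (2 * norm (x k) + N x * norm (majorant k))) \<in> X"
proof -
  let ?p = "\<lambda>k. of_real (2 * norm (x k) + N x * norm (majorant k)) :: 'a"
  let ?r = "(B ^^ n t) x - scale_seq (coeff (m t) x) (y t)"
  have xX: "x \<in> X" using x by (rule block_space_in)
  have "(\<lambda>k. of_real (norm (x k)) :: 'a) \<in> X" "(\<lambda>k. of_real (norm (majorant k)) :: 'a) \<in> X"
    using solid(1)[OF xX] solid(1)[OF majorant_in] at_0[OF xX] at_0[OF majorant_in] by auto
  then have "scale_seq 2 (\<lambda>k. of_real (norm (x k)) :: 'a) + scale_seq (of_real (N x)) (\<lambda>k. of_real (norm (majorant k))) \<in> X"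
    by (intro add_in scale_in)
  moreover have "scale_seq 2 (\<lambda>k. of_real (norm (x k)) :: 'a) + scale_seq (of_real (N x)) (\<lambda>k. of_real (norm (majorant k))) = ?p"
    by (auto simp: scale_seq_def)
  ultimately show p: "?p \<in> X" by simp
  have rX: "?r \<in> X" by (intro diff_in B_iter_in scale_in target_in xX)
  have "?r \<in> X \<and> N ?r \<le> N (restrict_seq {n t<..} ?p)"
  proof (rule dominated[where S = "{1..}" and \<sigma> = "\<lambda>k. k + n t"])
    show "?r k = 0" if "k \<notin> {1..}" for k using that at_0[OF rX] by (simp add: not_le)
    fix k :: nat assume "k \<in> {1..}"
    then have k: "1 \<le> k" by simp
    define j where "j = k + n t"
    have j: "n t < j" "1 \<le> j" using k by (auto simp: j_def)
    have pj: "norm (restrict_seq {n t<..} ?p j) = 2 * norm (x j) + N x * norm (majorant j)"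
      using j N_nonneg[OF xX] by (simp add: restrict_seq_def norm_of_real del: of_real_add of_real_mult)
    have "norm (?r k) * u k \<le> (2 * norm (x j) + N x * norm (majorant j)) * u j"
    proof (cases "j \<in> block t")
      case True
      have "(B ^^ n t) x k = (\<Prod>\<nu>=1..n t. w (\<nu> + k)) * (coeff (m t) x * preimage t j)"
        using B_iter_coord[OF xX k, of "n t"] block_space_block[OF x True] by (simp only: j_def)
      \<comment> \<open>On the current block the weight product cancels the divisor in
        \<open>preimage\<close>, so the remainder is exactly 0 there.\<close>
      also have "\<dots> = coeff (m t) x * y t k"
        using True w_nonzero by (simp add: preimage_def j_def)
      finally show ?thesis using u_pos[OF j(2)] N_nonneg[OF xX] by (simp add: scale_seq_def)
    next
      case False
      then have "y t k = 0" using k by (intro target_support) (auto simp: block_def j_def)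
      then have eq: "norm (?r k) * u k = growth (n t) k * (norm (x j) * u j)"
        using norm_B_iter[OF xX k, of "n t"] by (simp add: scale_seq_def j_def)
      consider s where "j \<in> block s" | s where "j = q s" | "x j = 0"
        using block_space_zero[OF x, of j] by blast
      then show ?thesis
      proof cases
        case 1
        have "\<not> s < t"
          using 1 j(1) pivot_less[of s t] below_pivot[of s] by (auto simp: block_def)
        then have "t < s" using 1 False by (cases s t rule: linorder_cases) auto
        then have "growth (n t) k \<le> K s" using K_ge k by blast
        moreover have "norm (x j) \<le> N x * norm (preimage s j)"
        proof -
          have "norm (coeff (m s) x) \<le> N x"
            using coord_le[OF xX pivot_pos, of "m s"] u_pos[OF pivot_pos, of "m s"]
            by (simp add: coeff_def norm_mult)
          then show ?thesis by (simp only: block_space_block[OF x 1] norm_mult mult_right_mono norm_ge_zero)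
        qed
        ultimately have "growth (n t) k * norm (x j) \<le> K s * (N x * norm (preimage s j))"
          using K_ge_1[of s] by (intro mult_mono) auto
        also have "\<dots> = N x * norm (majorant j)"
          using K_ge_1[of s] by (simp add: majorant_block[OF 1] norm_mult)
        also have "\<dots> \<le> 2 * norm (x j) + N x * norm (majorant j)" by simp
        finally show ?thesis unfolding eq mult.assoc[symmetric]
          using u_pos[OF j(2)] by (intro mult_right_mono) auto
      next
        case 2
        have "\<not> s < t" using 2 j(1) pivot_less[of s t] by auto
        then have "growth (n t) (q s - n t) \<le> 2" by (intro suffix n_mono) simp
        then have "growth (n t) k \<le> 2" using 2 by (simp add: j_def flip: 2)
        then have "growth (n t) k * norm (x j) \<le> 2 * norm (x j)" by (intro mult_right_mono) auto
        also have "\<dots> \<le> 2 * norm (x j) + N x * norm (majorant j)" using N_nonneg[OF xX] by simp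
        finally show ?thesis unfolding eq mult.assoc[symmetric]
          using u_pos[OF j(2)] by (intro mult_right_mono) auto
      next
        case 3
        then show ?thesis unfolding eq using u_pos[OF j(2)] N_nonneg[OF xX] by simp
      qed
    qed
    then show "norm (?r k) * u k \<le> norm (restrict_seq {n t<..} ?p (k + n t)) * u (k + n t)"
      using pj by (simp add: j_def)
  qed (use restrict_in[OF p] in auto)
  then show "N ?r \<le> N (restrict_seq {n t<..} ?p)" by blast
qed

lemma hypercyclic_block_space:
  assumes x: "x \<in> block_space" "x \<noteq> 0"
  shows "hypercyclic_vector (norm_topology X N) B x"
  unfolding hypercyclic_vector_iff
proof (intro conjI ballI allI impI)
  show xX: "x \<in> X" using x(1) by (rule block_space_in)
  \<comment> \<open>The defining equations determine all coordinates from those at the pivots, so a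
    nonzero vector has a nonzero pivot coordinate.\<close>
  have "\<exists>\<mu>. x (q \<mu>) \<noteq> 0"
  proof (rule ccontr)
    assume "\<not> (\<exists>\<mu>. x (q \<mu>) \<noteq> 0)"
    then have "coeff \<mu> x = 0" for \<mu> by (simp add: coeff_def)
    then have "x k = 0" for k
      using block_space_block[OF x(1), of k] block_space_zero[OF x(1), of k] \<open>\<not> (\<exists>\<mu>. x (q \<mu>) \<noteq> 0)\<close>
      by (metis UN_E imageE mult_zero_left)
    then show False using x(2) by (auto simp: fun_eq_iff)
  qed
  then obtain \<mu> where \<mu>: "x (q \<mu>) \<noteq> 0" by blast
  define c where "c = coeff \<mu> x"
  have c: "c \<noteq> 0" using \<mu> u_pos[OF pivot_pos, of \<mu>] by (simp add: c_def coeff_def)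
  fix z and e :: real assume z: "z \<in> X" and e: "0 < e"
  let ?p = "\<lambda>k. of_real (2 * norm (x k) + N x * norm (majorant k)) :: 'a"
  obtain T where T: "\<And>j. T \<le> j \<Longrightarrow> N (restrict_seq {j<..} ?p) < e / 2"
    using order_tendstoD(2)[OF tail[OF remainder_le(2)[OF x(1)]], of "e/2"] e
    unfolding eventually_sequentially by auto
  \<comment> \<open>The orbit approaches \<open>scale_seq c (y t)\<close>, so \<open>y t\<close> is
    taken close to \<open>z\<close> divided by \<open>c\<close>. \<open>Suc T\<close> rather than
    \<open>T\<close> ensures \<open>1 \<le> n t\<close>.\<close>
  obtain t where t: "Suc T \<le> t" "m t = \<mu>" "N (y t - scale_seq (inverse c) z) < e / (2 * norm c)"
    using targets_dense[OF scale_in[OF z], of "e / (2 * norm c)" "Suc T" \<mu> "inverse c"] e c by auto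
  let ?r = "(B ^^ n t) x - scale_seq c (y t)" and ?d = "y t - scale_seq (inverse c) z"
  have "(B ^^ n t) x - z = ?r + scale_seq c ?d"
    using c by (auto simp: scale_seq_def algebra_simps mult.assoc[symmetric])
  moreover have "?r \<in> X" "?d \<in> X"
    by (intro diff_in B_iter_in scale_in target_in xX z)+
  ultimately have "N ((B ^^ n t) x - z) \<le> N ?r + N (scale_seq c ?d)"
    using N_add scale_in by metis
  also have "N (scale_seq c ?d) = norm c * N ?d" using \<open>?d \<in> X\<close> by (rule N_scale)
  also have "norm c * N ?d < e / 2" using t(3) c by (simp add: field_simps)
  also have "N ?r < e / 2"
    using remainder_le(1)[OF x(1), of t] T[of "n t"] n_ge[of t] t(1,2) by (simp add: c_def)
  finally have "N ((B ^^ n t) x - z) < e" by (simp only: field_sum_of_halves)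
  moreover have "1 \<le> n t" using n_ge[of t] t(1) by simp
  ultimately show "\<exists>n\<ge>1. N ((B ^^ n) x - z) < e" by blast
qed

lemma hypercyclic_subspace_block_space:
  "hypercyclic_subspace (norm_topology X N) B block_space"
  unfolding hypercyclic_subspace_def mtopology_eq[symmetric]
  using closedin_block_space subspace_block_space not_finite_span_block_space hypercyclic_block_space
  by (auto simp: mtopology_eq)

end

section \<open>Characterisation by the growth factors\<close>

context weighted_shift_space
begin

lemma exists_hypercyclic_subspace:
  assumes "hypercyclic (norm_topology X N) B"
    and "\<And>n. 1 \<le> n \<Longrightarrow> \<exists>k\<ge>1. growth n k \<le> b"
  shows "\<exists>M. hypercyclic_subspace (norm_topology X N) B M"
proof -
  obtain y :: "nat \<Rightarrow> nat \<Rightarrow> 'a" and I m :: "nat \<Rightarrow> nat"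
    where y: "\<And>t k. k \<notin> {1..I t} \<Longrightarrow> y t k = 0"
      "\<And>z e \<mu> T. z \<in> X \<Longrightarrow> 0 < e \<Longrightarrow> \<exists>t\<ge>T. m t = \<mu> \<and> N (y t - z) < e"
    using target_schedule by metis
  obtain n q :: "nat \<Rightarrow> nat" and K :: "nat \<Rightarrow> real"
    where nqK: "\<And>s. n s + I s < q s" "\<And>s. q s < n (Suc s)"
      "\<And>s l. l \<le> n s \<Longrightarrow> growth l (q s - l) \<le> 2"
      "\<And>s. 1 \<le> K s" "\<And>s t k. t < s \<Longrightarrow> 1 \<le> k \<Longrightarrow> growth (n t) k \<le> K s"
      "\<And>s i. i \<in> {1..I s} \<Longrightarrow> K s * (2 ^ s * ((\<Sum>j\<in>{1..I s}. norm (y s j) * u j) + 1)) \<le> growth (n s) i"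
    by (rule interlacing[OF assms, of I "\<lambda>s. 2 ^ s * ((\<Sum>j\<in>{1..I s}. norm (y s j) * u j) + 1)"]) (assumption, rule that)
  interpret interlaced_blocks X N u w B n q I m K y
    by unfold_locales (rule nqK y; assumption)+
  show ?thesis using hypercyclic_subspace_block_space by blast
qed

text \<open>The conditions form a cycle: a hypercyclic subspace gives \<open>S \<le> 1\<close>,
  which gives \<open>S < \<infinity>\<close>, which gives back a subspace. Thus any finite bound
  improves itself to 1.\<close>

lemma hypercyclic_subspace_iff:
  assumes hyp: "hypercyclic (norm_topology X N) B"
  defines "S \<equiv> (SUP n\<in>{1::nat..}. INF k\<in>{1::nat..}. ereal (growth n k))"
  shows "(\<exists>M. hypercyclic_subspace (norm_topology X N) B M) \<longleftrightarrow> S \<le> 1"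
    and "(\<exists>M. hypercyclic_subspace (norm_topology X N) B M) \<longleftrightarrow> S < \<infinity>"
proof -
  have 1: "S \<le> 1" if M: "hypercyclic_subspace (norm_topology X N) B M" for M
  proof (rule ccontr)
    assume "\<not> S \<le> 1"
    then obtain n :: nat where n: "1 \<le> n" "1 < (INF k\<in>{1::nat..}. ereal (growth n k))"
      unfolding S_def not_le less_SUP_iff by (elim bexE) (simp only: atLeast_iff)
    obtain d where d: "1 < ereal d" "ereal d < (INF k\<in>{1::nat..}. ereal (growth n k))"
      using ereal_dense2[OF n(2)] by blast
    have "d \<le> growth n k" if "1 \<le> k" for k
    proof -
      have "(INF k\<in>{1::nat..}. ereal (growth n k)) \<le> ereal (growth n k)"
        using that by (intro INF_lower) auto
      then have "ereal d < ereal (growth n k)" by (rule less_le_trans[OF d(2)])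
      then show ?thesis by simp
    qed
    then show False using no_hypercyclic_subspace[of d n] d(1) n(1) M by simp
  qed
  have 2: "S < \<infinity>" if "S \<le> 1"
    using that by (rule le_less_trans) simp
  have 3: "\<exists>M. hypercyclic_subspace (norm_topology X N) B M" if S: "S < \<infinity>"
  proof -
    obtain b where b: "S < ereal b" using ereal_dense2[OF S] by blast
    have "\<exists>k\<ge>1. growth n k \<le> b" if "1 \<le> n" for n
    proof -
      have "(INF k\<in>{1::nat..}. ereal (growth n k)) \<le> S"
        unfolding S_def using that by (intro SUP_upper) auto
      then have "(INF k\<in>{1::nat..}. ereal (growth n k)) < ereal b" using b by (rule le_less_trans)
      then obtain k where "k \<in> {1..}" "ereal (growth n k) < ereal b" unfolding INF_less_iff by blast
      then show ?thesis by (intro exI[of _ k]) simp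
    qed
    then show ?thesis by (rule exists_hypercyclic_subspace[OF hyp])
  qed
  show "(\<exists>M. hypercyclic_subspace (norm_topology X N) B M) \<longleftrightarrow> S \<le> 1"
  proof
    assume "\<exists>M. hypercyclic_subspace (norm_topology X N) B M"
    then show "S \<le> 1" by (elim exE) (rule 1)
  qed (rule 3[OF 2])
  show "(\<exists>M. hypercyclic_subspace (norm_topology X N) B M) \<longleftrightarrow> S < \<infinity>"
  proof
    assume "\<exists>M. hypercyclic_subspace (norm_topology X N) B M"
    then show "S < \<infinity>" by (elim exE) (rule 2[OF 1])
  qed (rule 3)
qed

end

section \<open>The spaces \<open>l\<^sup>p(v)\<close> and \<open>c\<^sub>0(v)\<close>\<close>

text \<open>The form of \<open>dominated\<close> for sums of nonnegative terms: injectivity of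
  \<open>\<sigma>\<close> turns the bound into a comparison with a subsum of
  \<open>g\<close>.\<close>

lemma infsum_dominated:
  fixes f g :: "nat \<Rightarrow> real"
  assumes g: "g summable_on B" "\<And>k. k \<in> B \<Longrightarrow> 0 \<le> g k"
    and \<sigma>: "inj_on \<sigma> S" "S \<subseteq> A" "\<sigma> ` S \<subseteq> B"
    and f: "\<And>k. k \<in> A - S \<Longrightarrow> f k = 0" "\<And>k. k \<in> S \<Longrightarrow> 0 \<le> f k" "\<And>k. k \<in> S \<Longrightarrow> f k \<le> g (\<sigma> k)"
  shows "f summable_on A" "infsum f A \<le> infsum g B"
proof -
  have gS: "g summable_on \<sigma> ` S" using g(1) \<sigma>(3) by (rule summable_on_subset_banach)
  then have g\<sigma>: "(g \<circ> \<sigma>) summable_on S" using summable_on_reindex[OF \<sigma>(1)] by blast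
  have fS: "f summable_on S"
    by (rule summable_on_comparison_test[OF g\<sigma>]) (use f in auto)
  have "f summable_on A \<longleftrightarrow> f summable_on S"
    by (rule summable_on_cong_neutral) (use f \<sigma>(2) in auto)
  with fS show "f summable_on A" by simp
  have "infsum f A = infsum f S"
    by (rule infsum_cong_neutral) (use f \<sigma>(2) in auto)
  also have "\<dots> \<le> infsum (g \<circ> \<sigma>) S"
    using fS g\<sigma> f(3) by (intro infsum_mono) auto
  also have "\<dots> = infsum g (\<sigma> ` S)" using infsum_reindex[OF \<sigma>(1), of g] by simp
  also have "\<dots> \<le> infsum g B"
    using gS g \<sigma>(3) by (intro infsum_mono_neutral) auto
  finally show "infsum f A \<le> infsum g B" .
qed

lemma infsum_greaterThan_tendsto_0:
  fixes f :: "nat \<Rightarrow> real"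
  assumes "f summable_on UNIV"
  shows "(\<lambda>n. infsum f {n<..}) \<longlonglongrightarrow> 0"
proof -
  have eq: "infsum f {n<..} = infsum f UNIV - sum f {..n}" for n
  proof -
    have "infsum f ({..n} \<union> {n<..}) = infsum f {..n} + infsum f {n<..}"
      using summable_on_subset_banach[OF assms] by (intro infsum_Un_disjoint) auto
    moreover have "{..n} \<union> {n<..} = UNIV" by auto
    ultimately show ?thesis by simp
  qed
  have "f sums infsum f UNIV" using assms by (intro has_sum_imp_sums has_sum_infsum)
  then have "(\<lambda>n. infsum f UNIV - sum f {..n}) \<longlonglongrightarrow> infsum f UNIV - infsum f UNIV"
    by (intro tendsto_intros) (simp add: sums_def_le)
  then show ?thesis by (simp add: eq)
qed

lemma weighted_seq_space_lp:
  fixes v :: "nat \<Rightarrow> real"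
  assumes v: "\<forall>n\<ge>1. 0 < v n" and p: "1 \<le> p"
  shows "weighted_seq_space (lp_space p v :: (nat \<Rightarrow> 'a::{real_normed_field,banach,second_countable_topology}) set)
           (lp_norm p v) (\<lambda>k. v k powr (1 / p))"
proof -
  define F where "F = (\<lambda>(x :: nat \<Rightarrow> 'a) n. norm (x n) powr p * v n)"
  have vp: "0 < v k" if "k \<in> {1..}" for k using v that by auto
  have F0: "0 \<le> F x k" if "k \<in> {1..}" for x k using vp[OF that] by (simp add: F_def)
  have mem: "x \<in> lp_space p v \<longleftrightarrow> x 0 = 0 \<and> F x summable_on {1..}" for x
    by (simp add: lp_space_def F_def)
  have N: "lp_norm p v x = infsum (F x) {1..} powr (1 / p)" for x
    by (simp add: lp_norm_def F_def)
  have I0: "0 \<le> infsum (F x) {1..}" for x using F0 by (intro infsum_nonneg) auto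
  \<comment> \<open>Each summand is the \<open>p\<close>-th power of a normalised coordinate, so the
    comparison hypothesis of \<open>dominated\<close> becomes a comparison of summands.\<close>
  have F_eq: "F x k = (norm (x k) * v k powr (1 / p)) powr p" if "k \<in> {1..}" for x k
    using vp[OF that] p by (simp add: F_def powr_mult powr_powr)
  have F_restrict: "infsum (F (restrict_seq A x)) {1..} = infsum (F x) A" if "A \<subseteq> {1..}" for A x
    using that p by (intro infsum_cong_neutral) (auto simp: F_def restrict_seq_def)
  show ?thesis
  proof
    show "0 < v k powr (1 / p)" if "1 \<le> k" for k using vp[of k] that by simp
    show "seq.subspace (lp_space p v :: (nat \<Rightarrow> 'a) set)" using v p by (rule subspace_lp_space)
    fix x y :: "nat \<Rightarrow> 'a"
    show "x 0 = 0" if "x \<in> lp_space p v" using that by (simp add: mem)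
    show "0 \<le> lp_norm p v x" by (simp add: N)
    show "lp_norm p v (- x) = lp_norm p v x" by (simp add: lp_norm_def)
    show "lp_norm p v (x + y) \<le> lp_norm p v x + lp_norm p v y" if "x \<in> lp_space p v" "y \<in> lp_space p v"
      using lp_add[OF v p that] by simp
    show "lp_norm p v (scale_seq c x) \<le> norm c * lp_norm p v x" if "x \<in> lp_space p v" for c
    proof -
      have "F (scale_seq c x) = (\<lambda>k. norm c powr p * F x k)"
        by (auto simp: F_def scale_seq_def norm_mult powr_mult)
      then have "infsum (F (scale_seq c x)) {1..} = norm c powr p * infsum (F x) {1..}"
        by (simp add: infsum_cmult_right')
      then show ?thesis using p I0 by (simp add: N powr_mult powr_powr)
    qed
    show "unit_seq k \<in> (lp_space p v :: (nat \<Rightarrow> 'a) set)"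
      and "lp_norm p v (unit_seq k :: nat \<Rightarrow> 'a) = v k powr (1 / p)" if k: "1 \<le> k" for k
    proof -
      have "F (unit_seq k) summable_on {1..} \<longleftrightarrow> F (unit_seq k) summable_on {k}"
        using k by (intro summable_on_cong_neutral) (auto simp: F_def unit_seq_def)
      then show "unit_seq k \<in> (lp_space p v :: (nat \<Rightarrow> 'a) set)"
        using k by (simp add: mem unit_seq_def)
      have "infsum (F (unit_seq k)) {1..} = infsum (F (unit_seq k)) {k}"
        using k by (intro infsum_cong_neutral) (auto simp: F_def unit_seq_def)
      then show "lp_norm p v (unit_seq k :: nat \<Rightarrow> 'a) = v k powr (1 / p)"
        using k by (simp add: N F_def unit_seq_def)
    qed
    show "x \<in> lp_space p v \<and> lp_norm p v x \<le> lp_norm p v y"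
      if y: "y \<in> lp_space p v" and \<sigma>: "inj_on \<sigma> S" "S \<subseteq> {1..}" "\<sigma> ` S \<subseteq> {1..}"
        and x: "\<And>k. k \<notin> S \<Longrightarrow> x k = 0"
          "\<And>k. k \<in> S \<Longrightarrow> norm (x k) * v k powr (1 / p) \<le> norm (y (\<sigma> k)) * v (\<sigma> k) powr (1 / p)"
      for \<sigma> :: "nat \<Rightarrow> nat" and S
    proof -
      have "F x k \<le> F y (\<sigma> k)" if "k \<in> S" for k
        using x(2)[OF that] that \<sigma> p F_eq[of k x] F_eq[of "\<sigma> k" y]
        by (auto simp: image_subset_iff subset_iff intro!: powr_mono2)
      then have "F x summable_on {1..}" "infsum (F x) {1..} \<le> infsum (F y) {1..}"
        using infsum_dominated[of "F y" "{1..}" \<sigma> S "{1..}" "F x"] y F0 \<sigma> x(1) p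
        by (auto simp: mem F_def subset_iff)
      moreover have "x 0 = 0" using x(1)[of 0] \<sigma>(2) by auto
      ultimately show ?thesis using p I0 by (auto simp: mem N intro!: powr_mono2)
    qed
    show "(\<lambda>n. lp_norm p v (restrict_seq {n<..} x)) \<longlonglongrightarrow> 0" if x: "x \<in> lp_space p v"
    proof -
      have "F x summable_on UNIV \<longleftrightarrow> F x summable_on {1..}"
        using x p by (intro summable_on_cong_neutral) (auto simp: mem F_def not_le)
      then have "(\<lambda>n. infsum (F x) {n<..} powr (1 / p)) \<longlonglongrightarrow> 0 powr (1 / p)"
        using x p F0 by (intro tendsto_powr' infsum_greaterThan_tendsto_0 tendsto_const)
          (auto simp: mem intro!: always_eventually infsum_nonneg)
      moreover have "infsum (F (restrict_seq {n<..} x)) {1..} = infsum (F x) {n<..}" for n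
        by (rule F_restrict) auto
      ultimately show ?thesis using p by (simp only: N) simp
    qed
    show "x \<in> lp_space p v" if x: "x 0 = 0" "\<And>e. 0 < e \<Longrightarrow> \<exists>n. \<forall>m. lp_norm p v (restrict_seq {n<..m} x) \<le> e"
    proof -
      \<comment> \<open>The single tolerance 1 suffices: it bounds all finite partial sums of the
        nonnegative summands, and bounded partial sums give summability.\<close>
      obtain n where n: "\<And>m. lp_norm p v (restrict_seq {n<..m} x) \<le> 1" using x(2)[of 1] by auto
      have le1: "sum (F x) {n<..m} \<le> 1" for m
      proof -
        have "0 \<le> sum (F x) {n<..m}" using F0 by (intro sum_nonneg) auto
        moreover have "sum (F x) {n<..m} powr (1 / p) \<le> 1"
        proof -
          have "infsum (F (restrict_seq {n<..m} x)) {1..} = sum (F x) {n<..m}"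
            by (subst F_restrict) auto
          then show ?thesis using n[of m] by (simp only: N)
        qed
        ultimately show ?thesis
          using p powr_less_mono2[of "1 / p" 1 "sum (F x) {n<..m}"] by (auto simp: not_less[symmetric])
      qed
      have "sum (F x) A \<le> sum (F x) {1..n} + 1" if A: "finite A" "A \<subseteq> {1..}" for A
      proof -
        obtain m where m: "\<And>k. k \<in> A \<Longrightarrow> k \<le> m" using A(1) unfolding finite_nat_set_iff_bounded_le by blast
        have "sum (F x) A \<le> sum (F x) ({1..n} \<union> {n<..m})"
          using A m F0 by (intro sum_mono2) (auto simp: not_le)
        also have "\<dots> = sum (F x) {1..n} + sum (F x) {n<..m}" by (intro sum.union_disjoint) auto
        finally show ?thesis using le1[of m] by simp
      qed
      then have "F x summable_on {1..}"
        using F0 by (intro nonneg_bdd_above_summable_on) (auto simp: bdd_above_def)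
      then show ?thesis using x(1) by (simp add: mem)
    qed
  qed
qed

lemma c0_norm_le: "(\<And>k. 1 \<le> k \<Longrightarrow> norm (x k) * v k \<le> b) \<Longrightarrow> c0_norm v x \<le> b"
  unfolding c0_norm_def by (rule cSUP_least) auto

lemma weighted_seq_space_c0:
  fixes v :: "nat \<Rightarrow> real"
  assumes v: "\<forall>n\<ge>1. 0 < v n"
  shows "weighted_seq_space (c0_space v :: (nat \<Rightarrow> 'a::{real_normed_field,banach,second_countable_topology}) set)
           (c0_norm v) v"
proof -
  have v0: "0 \<le> norm (x k) * v k" if "1 \<le> k" for x :: "nat \<Rightarrow> 'a" and k
    using v that by (simp add: less_imp_le)
  have mem: "x \<in> c0_space v \<longleftrightarrow> x 0 = 0 \<and> (\<forall>e>0. \<exists>n. \<forall>k>n. norm (x k) * v k < e)" for x :: "nat \<Rightarrow> 'a"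
  proof -
    have "(\<lambda>k. norm (x k) * v k) \<longlonglongrightarrow> 0 \<longleftrightarrow> (\<forall>e>0. \<exists>n. \<forall>k>n. norm (x k) * v k < e)"
    proof
      assume "(\<lambda>k. norm (x k) * v k) \<longlonglongrightarrow> 0"
      then show "\<forall>e>0. \<exists>n. \<forall>k>n. norm (x k) * v k < e"
        using order_tendstoD(2)[of "\<lambda>k. norm (x k) * v k" 0 sequentially]
        unfolding eventually_sequentially by (blast intro: less_imp_le)
    next
      assume A: "\<forall>e>0. \<exists>n. \<forall>k>n. norm (x k) * v k < e"
      show "(\<lambda>k. norm (x k) * v k) \<longlonglongrightarrow> 0"
      proof (rule LIMSEQ_I)
        fix e :: real assume "0 < e"
        then obtain n where n: "\<And>k. n < k \<Longrightarrow> norm (x k) * v k < e" using A by blast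
        have "norm (norm (x k) * v k - 0) < e" if "Suc n \<le> k" for k
          using n[of k] v0[of k x] that by simp
        then show "\<exists>n. \<forall>k\<ge>n. norm (norm (x k) * v k - 0) < e" by blast
      qed
    qed
    then show ?thesis by (simp add: c0_space_def)
  qed
  have fin: "restrict_seq {n<..m} x \<in> c0_space v" for n m and x :: "nat \<Rightarrow> 'a"
    by (auto simp: mem restrict_seq_def intro!: exI[of _ m])
  have nonneg: "0 \<le> c0_norm v x" if "x \<in> c0_space v" for x :: "nat \<Rightarrow> 'a"
    using order_trans[OF v0[of 1 x] c0_norm_upper[OF that, of 1]] by simp
  show ?thesis
  proof
    show "0 < v k" if "1 \<le> k" for k using v that by simp
    show "seq.subspace (c0_space v :: (nat \<Rightarrow> 'a) set)" using v by (rule subspace_c0_space)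
    fix x y :: "nat \<Rightarrow> 'a"
    show "x 0 = 0" if "x \<in> c0_space v" using that by (simp add: mem)
    show "0 \<le> c0_norm v x" if "x \<in> c0_space v" using that by (rule nonneg)
    show "c0_norm v (- x) = c0_norm v x" by (simp add: c0_norm_def)
    show "c0_norm v (x + y) \<le> c0_norm v x + c0_norm v y" if "x \<in> c0_space v" "y \<in> c0_space v"
      using c0_add[OF v that] by simp
    show "c0_norm v (scale_seq c x) \<le> norm c * c0_norm v x" if "x \<in> c0_space v" for c
      using c0_norm_upper[OF that]
      by (intro c0_norm_le) (simp add: scale_seq_def norm_mult mult.assoc mult_left_mono)
    show u: "unit_seq k \<in> (c0_space v :: (nat \<Rightarrow> 'a) set)" for k
      by (auto simp: mem unit_seq_def intro!: exI[of _ k])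
    show "c0_norm v (unit_seq k :: nat \<Rightarrow> 'a) = v k" if k: "1 \<le> k" for k
    proof (rule antisym)
      show "c0_norm v (unit_seq k :: nat \<Rightarrow> 'a) \<le> v k"
        using v k by (intro c0_norm_le) (auto simp: unit_seq_def less_imp_le)
      show "v k \<le> c0_norm v (unit_seq k :: nat \<Rightarrow> 'a)"
        using c0_norm_upper[OF u k, of k] k by (simp add: unit_seq_def)
    qed
    show "x \<in> c0_space v \<and> c0_norm v x \<le> c0_norm v y"
      if y: "y \<in> c0_space v" and \<sigma>: "inj_on \<sigma> S" "S \<subseteq> {1..}" "\<sigma> ` S \<subseteq> {1..}"
        and x: "\<And>k. k \<notin> S \<Longrightarrow> x k = 0" "\<And>k. k \<in> S \<Longrightarrow> norm (x k) * v k \<le> norm (y (\<sigma> k)) * v (\<sigma> k)"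
      for \<sigma> :: "nat \<Rightarrow> nat" and S
    proof
      have "\<exists>n. \<forall>k>n. norm (x k) * v k < e" if e: "0 < e" for e
      proof -
        obtain m where m: "\<And>j. m < j \<Longrightarrow> norm (y j) * v j < e" using y e by (auto simp: mem)
        \<comment> \<open>By injectivity only finitely many indices in \<open>S\<close> are mapped
          into \<open>{..m}\<close>; beyond them \<open>\<sigma> k\<close> lies where
          \<open>y\<close> is small.\<close>
        have "finite (\<sigma> -` {..m} \<inter> S)" using \<sigma>(1) by (intro finite_vimage_IntI) auto
        then obtain n where n: "\<And>k. k \<in> \<sigma> -` {..m} \<inter> S \<Longrightarrow> k \<le> n"
          unfolding finite_nat_set_iff_bounded_le by blast
        have "norm (x k) * v k < e" if "n < k" for k
        proof (cases "k \<in> S")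
          case True
          then have "m < \<sigma> k" using n[of k] that by (auto simp: not_le[symmetric])
          then show ?thesis by (intro le_less_trans[OF x(2)[OF True]] m)
        qed (use x(1) e in simp)
        then show ?thesis by blast
      qed
      then show "x \<in> c0_space v" using x(1)[of 0] \<sigma>(2) by (auto simp: mem)
      show "c0_norm v x \<le> c0_norm v y"
      proof (rule c0_norm_le)
        fix k
        show "norm (x k) * v k \<le> c0_norm v y"
        proof (cases "k \<in> S")
          case True
          then have "1 \<le> \<sigma> k" using \<sigma>(3) by auto
          then show ?thesis by (intro order_trans[OF x(2)[OF True]] c0_norm_upper[OF y])
        qed (use x(1) nonneg[OF y] in simp)
      qed
    qed
    show "(\<lambda>n. c0_norm v (restrict_seq {n<..} x)) \<longlonglongrightarrow> 0" if x: "x \<in> c0_space v"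
    proof (rule LIMSEQ_I)
      fix e :: real assume "0 < e"
      then obtain m where m: "\<And>k. m < k \<Longrightarrow> norm (x k) * v k < e / 2"
        using conjunct2[OF x[unfolded mem], rule_format, OF half_gt_zero] by blast
      have "norm (c0_norm v (restrict_seq {n<..} x) - 0) < e" if "m \<le> n" for n
      proof -
        have le: "norm (restrict_seq {n<..} x k) * v k \<le> norm (x k) * v k" if "1 \<le> k" for k
          using v0[OF that, of x] by (simp add: restrict_seq_def)
        have "restrict_seq {n<..} x \<in> c0_space v"
          unfolding mem
        proof (intro conjI allI impI)
          fix e :: real assume "0 < e"
          then obtain j where j: "\<And>k. j < k \<Longrightarrow> norm (x k) * v k < e"
            using conjunct2[OF x[unfolded mem], rule_format] by blast
          have "norm (restrict_seq {n<..} x k) * v k < e" if "j < k" for k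
            using le_less_trans[OF le[of k] j[OF that]] that by simp
          then show "\<exists>j. \<forall>k>j. norm (restrict_seq {n<..} x k) * v k < e" by blast
        qed (simp add: restrict_seq_def)
        moreover have "c0_norm v (restrict_seq {n<..} x) \<le> e / 2"
          using m that \<open>0 < e\<close> by (intro c0_norm_le) (auto simp: restrict_seq_def less_imp_le)
        ultimately show ?thesis using nonneg[of "restrict_seq {n<..} x"] \<open>0 < e\<close> by simp
      qed
      then show "\<exists>m. \<forall>n\<ge>m. norm (c0_norm v (restrict_seq {n<..} x) - 0) < e" by blast
    qed
    show "x \<in> c0_space v" if x: "x 0 = 0" "\<And>e. 0 < e \<Longrightarrow> \<exists>n. \<forall>m. c0_norm v (restrict_seq {n<..m} x) \<le> e"
      unfolding mem
    proof (intro conjI allI impI)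
      fix e :: real assume "0 < e"
      then obtain n where n: "\<And>m. c0_norm v (restrict_seq {n<..m} x) \<le> e / 2"
        using x(2)[of "e / 2"] by auto
      have "norm (x k) * v k < e" if "n < k" for k
        using c0_norm_upper[OF fin, of k n k x] n[of k] that \<open>0 < e\<close> by (simp add: restrict_seq_def)
      then show "\<exists>n. \<forall>k>n. norm (x k) * v k < e" by blast
    qed (fact x)
  qed
qed

lemma lp_hypercyclic_subspace_iff:
  fixes w :: "nat \<Rightarrow> 'a::{real_normed_field,banach,second_countable_topology}"
  assumes v: "\<forall>n\<ge>1. 0 < v n" and p: "1 \<le> p"
    and B: "weighted_shift (lp_topology p v) w B" "hypercyclic (lp_topology p v) B"
  shows "(\<exists>M. hypercyclic_subspace (lp_topology p v) B M) \<longleftrightarrow> lp_sup_inf p v w \<le> 1"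
    and "(\<exists>M. hypercyclic_subspace (lp_topology p v) B M) \<longleftrightarrow> lp_sup_inf p v w < \<infinity>"
proof -
  interpret weighted_seq_space "lp_space p v :: (nat \<Rightarrow> 'a) set" "lp_norm p v" "\<lambda>k. v k powr (1 / p)"
    by (rule weighted_seq_space_lp[OF v p])
  interpret weighted_shift_space "lp_space p v" "lp_norm p v" "\<lambda>k. v k powr (1 / p)" w B
    using B(1) by unfold_locales (simp add: lp_topology_def)
  \<comment> \<open>The \<open>p\<close>-th root of \<open>v k / v (k + n)\<close> is the quotient
    of the norms of the two unit sequences.\<close>
  have "lp_sup_inf p v w = (SUP n\<in>{1::nat..}. INF k\<in>{1::nat..}. ereal (growth n k))"
    using v unfolding lp_sup_inf_def growth_def
    by (intro SUP_cong INF_cong refl) (simp add: powr_divide less_imp_le)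
  then show "(\<exists>M. hypercyclic_subspace (lp_topology p v) B M) \<longleftrightarrow> lp_sup_inf p v w \<le> 1"
    and "(\<exists>M. hypercyclic_subspace (lp_topology p v) B M) \<longleftrightarrow> lp_sup_inf p v w < \<infinity>"
    using hypercyclic_subspace_iff B(2) by (simp_all only: lp_topology_def)
qed

lemma c0_hypercyclic_subspace_iff:
  fixes w :: "nat \<Rightarrow> 'a::{real_normed_field,banach,second_countable_topology}"
  assumes v: "\<forall>n\<ge>1. 0 < v n"
    and B: "weighted_shift (c0_topology v) w B" "hypercyclic (c0_topology v) B"
  shows "(\<exists>M. hypercyclic_subspace (c0_topology v) B M) \<longleftrightarrow> c0_sup_inf v w \<le> 1"
    and "(\<exists>M. hypercyclic_subspace (c0_topology v) B M) \<longleftrightarrow> c0_sup_inf v w < \<infinity>"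
proof -
  interpret weighted_seq_space "c0_space v :: (nat \<Rightarrow> 'a) set" "c0_norm v" v
    by (rule weighted_seq_space_c0[OF v])
  interpret weighted_shift_space "c0_space v" "c0_norm v" v w B
    using B(1) by unfold_locales (simp add: c0_topology_def)
  have "c0_sup_inf v w = (SUP n\<in>{1::nat..}. INF k\<in>{1::nat..}. ereal (growth n k))"
    unfolding c0_sup_inf_def growth_def ..
  then show "(\<exists>M. hypercyclic_subspace (c0_topology v) B M) \<longleftrightarrow> c0_sup_inf v w \<le> 1"
    and "(\<exists>M. hypercyclic_subspace (c0_topology v) B M) \<longleftrightarrow> c0_sup_inf v w < \<infinity>"
    using hypercyclic_subspace_iff B(2) by (simp_all only: c0_topology_def)
qed

theorem corollary4p6:
  fixes v :: "nat \<Rightarrow> real"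
  assumes "\<forall>n\<ge>1. 0 < v n"
  shows
    "(\<forall>p\<ge>1. \<forall>(w :: nat \<Rightarrow> real) B.
        weighted_shift (lp_topology p v) w B \<and> hypercyclic (lp_topology p v) B \<longrightarrow>
          ((\<exists>M. hypercyclic_subspace (lp_topology p v) B M) \<longleftrightarrow> lp_sup_inf p v w \<le> 1) \<and>
          ((\<exists>M. hypercyclic_subspace (lp_topology p v) B M) \<longleftrightarrow> lp_sup_inf p v w < \<infinity>)) \<and>
     (\<forall>p\<ge>1. \<forall>(w :: nat \<Rightarrow> complex) B.
        weighted_shift (lp_topology p v) w B \<and> hypercyclic (lp_topology p v) B \<longrightarrow>
          ((\<exists>M. hypercyclic_subspace (lp_topology p v) B M) \<longleftrightarrow> lp_sup_inf p v w \<le> 1) \<and>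
          ((\<exists>M. hypercyclic_subspace (lp_topology p v) B M) \<longleftrightarrow> lp_sup_inf p v w < \<infinity>)) \<and>
     (\<forall>(w :: nat \<Rightarrow> real) B.
        weighted_shift (c0_topology v) w B \<and> hypercyclic (c0_topology v) B \<longrightarrow>
          ((\<exists>M. hypercyclic_subspace (c0_topology v) B M) \<longleftrightarrow> c0_sup_inf v w \<le> 1) \<and>
          ((\<exists>M. hypercyclic_subspace (c0_topology v) B M) \<longleftrightarrow> c0_sup_inf v w < \<infinity>)) \<and>
     (\<forall>(w :: nat \<Rightarrow> complex) B.
        weighted_shift (c0_topology v) w B \<and> hypercyclic (c0_topology v) B \<longrightarrow>
          ((\<exists>M. hypercyclic_subspace (c0_topology v) B M) \<longleftrightarrow> c0_sup_inf v w \<le> 1) \<and>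
          ((\<exists>M. hypercyclic_subspace (c0_topology v) B M) \<longleftrightarrow> c0_sup_inf v w < \<infinity>))"
  by (intro conjI allI impI; elim conjE)
    (rule lp_hypercyclic_subspace_iff[OF assms] c0_hypercyclic_subspace_iff[OF assms]; assumption)+

end
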